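(* Let $V\subset\mathbf{R}^3$ be a rational polytop, let $G=G(V)$ and let $\Omega\subset S^2$ be a fundamental polygon for the action of $G$ on $S^2$. For any $\omega\in\Omega$ the directional billiard map $T_\omega:S\to S$ is a generalized polygon exchange, and $h(T_\omega)=0$.
   Context: $V$ is a closed connected polytop (3-dimensional compact Euclidean polyhedron) with faces $F_i$, $i\in I$. $G(V)\subset O(3)$ is the group generated by the reflections in the planes through the origin parallel to the faces $F_i$; $V$ is rational if $G(V)$ is finite. The billiard flow in $V$ moves a point with unit velocity along straight lines, reflecting elastically at $\partial V$; since reflections lie in $G$, the direction of a trajectory starting in direction $\omega$ stays in the orbit $G\omega$. The directional billiard flow $T^t_\omega$ is the restriction of the billiard flow to phase points with direction in $G\omega$; its cross-section $S$ consists of pairs (point of a face $F_i$, direction $g\omega$, $g\in G$, pointing into $V$), which for $\omega$ in the interior of $\Omega$ is a surface decomposed into $|I||G|/2$ polygons indexed by pairs $(F_i,g)$; $T_\omega:S\to S$ is the first return map of $T^t_\omega$ to $S$. A generalized polygon exchange on a partition $\mathcal{R}$ of a surface $S$ composed of polygons is a map whose restriction to each atom of $\mathcal{R}$ is a homeomorphism onto its image, smooth on interiors, images forming a partition, with $T$ and $T^{-1}$ continuous on atoms; here $\mathcal{R}$ is the partition of $S$ by the discontinuity lines of $T_\omega$. With $\mathcal{R}_n=\bigvee_{k=0}^{n-1}T_\omega^{-k}\mathcal{R}$ (atoms: intersections of atoms of the $T_\omega^{-k}\mathcal{R}$), $h(T_\omega,\mathcal{U})=\limsup_n\frac1n\log(\text{number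 of atoms of }\mathcal{U}_n)$ and $h(T_\omega)=\sup_{\mathcal{U}}h(T_\omega,\mathcal{U})$ over partitions $\mathcal{U}$ refining $\mathcal{R}$. *)

theory Defs
  imports "HOL-Analysis.Analysis" "HOL-Library.Liminf_Limsup"
begin

type_synonym pt = "real^3"
type_synonym phase = "pt \<times> pt"   (* (position, direction) *)

definition closed_polygon :: "pt set \<Rightarrow> bool" where
  "closed_polygon P \<longleftrightarrow>
     (\<exists>Q. finite Q \<and> Q \<noteq> {} \<and>
          (\<forall>q\<in>Q. \<exists>X. finite X \<and> q = convex hull X \<and> aff_dim q = 2) \<and>
          P = \<Union>Q) \<and> aff_dim P = 2"

definition reflect :: "pt \<Rightarrow> pt \<Rightarrow> pt" where
  "reflect n v = v - (2 * (n \<bullet> v)) *\<^sub>R n"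

definition polytop :: "pt set \<Rightarrow> 'i set \<Rightarrow> ('i \<Rightarrow> pt set) \<Rightarrow> ('i \<Rightarrow> pt) \<Rightarrow> bool" where
  "polytop V I F N \<longleftrightarrow>
     finite I \<and> I \<noteq> {} \<and> compact V \<and> connected V \<and> closure (interior V) = V \<and>
     frontier V = (\<Union>i\<in>I. F i) \<and>
     (\<forall>i\<in>I. closed_polygon (F i) \<and> norm (N i) = 1 \<and>
        (\<forall>x\<in>F i. \<forall>y\<in>F i. N i \<bullet> (x - y) = 0) \<and>
        (\<forall>x\<in>rel_interior (F i) - (\<Union>k\<in>I-{i}. F k).
            \<exists>e>0. \<forall>t. 0 < t \<and> t < e \<longrightarrow>
               x + t *\<^sub>R N i \<in> interior V \<and> x - t *\<^sub>R N i \<notin> V)) \<and>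
     (\<forall>i\<in>I. \<forall>j\<in>I. i \<noteq> j \<longrightarrow> rel_interior (F i) \<inter> rel_interior (F j) = {})"

text \<open>G(V): the group generated by the reflections in the planes through the origin
  parallel to the faces (generated as a monoid; the generators are involutions).\<close>
inductive_set refl_group :: "'i set \<Rightarrow> ('i \<Rightarrow> pt) \<Rightarrow> (pt \<Rightarrow> pt) set"
  for I :: "'i set" and N :: "'i \<Rightarrow> pt" where
  refl_group_id: "id \<in> refl_group I N"
| refl_group_step: "g \<in> refl_group I N \<Longrightarrow> i \<in> I \<Longrightarrow> reflect (N i) \<circ> g \<in> refl_group I N"

definition rational_polytop :: "pt set \<Rightarrow> 'i set \<Rightarrow> ('i \<Rightarrow> pt set) \<Rightarrow> ('i \<Rightarrow> pt) \<Rightarrow> bool" where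
  "rational_polytop V I F N \<longleftrightarrow> polytop V I F N \<and> finite (refl_group I N)"

definition sph_interior :: "pt set \<Rightarrow> pt set" where
  "sph_interior \<Omega> = {x\<in>\<Omega>. \<exists>e>0. ball x e \<inter> sphere 0 1 \<subseteq> \<Omega>}"

definition fundamental_polygon :: "(pt \<Rightarrow> pt) set \<Rightarrow> pt set \<Rightarrow> bool" where
  "fundamental_polygon G \<Omega> \<longleftrightarrow>
     \<Omega> \<subseteq> sphere 0 1 \<and> closed \<Omega> \<and> closure (sph_interior \<Omega>) = \<Omega> \<and>
     (\<Union>g\<in>G. g ` \<Omega>) = sphere 0 1 \<and>
     (\<forall>g\<in>G. \<forall>h\<in>G. g \<noteq> h \<longrightarrow> g ` sph_interior \<Omega> \<inter> h ` sph_interior \<Omega> = {}) \<and>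
     (\<exists>W. finite W \<and> 0 \<notin> W \<and>
          \<Omega> - sph_interior \<Omega> \<subseteq> (\<Union>w\<in>W. {x\<in>sphere 0 1. w \<bullet> x = 0}))"

definition cross_section :: "'i set \<Rightarrow> ('i \<Rightarrow> pt set) \<Rightarrow> ('i \<Rightarrow> pt) \<Rightarrow> pt \<Rightarrow> phase set" where
  "cross_section I F N \<omega> =
     {(x, v). v \<in> (\<lambda>g. g \<omega>) ` refl_group I N \<and> (\<exists>i\<in>I. x \<in> F i \<and> N i \<bullet> v > 0)}"

definition exit_time :: "pt set \<Rightarrow> pt \<Rightarrow> pt \<Rightarrow> real" where
  "exit_time V x v = Inf {t. t > 0 \<and> x + t *\<^sub>R v \<notin> interior V}"

definition hit_point :: "pt set \<Rightarrow> pt \<Rightarrow> pt \<Rightarrow> pt" where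
  "hit_point V x v = x + exit_time V x v *\<^sub>R v"

definition billiard_map :: "pt set \<Rightarrow> 'i set \<Rightarrow> ('i \<Rightarrow> pt set) \<Rightarrow> ('i \<Rightarrow> pt) \<Rightarrow> phase \<Rightarrow> phase" where
  "billiard_map V I F N p =
     (let y = hit_point V (fst p) (snd p);
          j = (THE j. j \<in> I \<and> y \<in> rel_interior (F j))
      in (y, reflect (N j) (snd p)))"

definition regular_set :: "pt set \<Rightarrow> 'i set \<Rightarrow> ('i \<Rightarrow> pt set) \<Rightarrow> ('i \<Rightarrow> pt) \<Rightarrow> pt \<Rightarrow> phase set" where
  "regular_set V I F N \<omega> =
     {(x, v). (x, v) \<in> cross_section I F N \<omega> \<and>
        (\<exists>i\<in>I. x \<in> rel_interior (F i) \<and> N i \<bullet> v > 0 \<and> (\<forall>k\<in>I-{i}. x \<notin> F k)) \<and>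
        (\<exists>j\<in>I. hit_point V x v \<in> rel_interior (F j) \<and>
                (\<forall>k\<in>I-{j}. hit_point V x v \<notin> F k))}"

definition discont_partition :: "pt set \<Rightarrow> 'i set \<Rightarrow> ('i \<Rightarrow> pt set) \<Rightarrow> ('i \<Rightarrow> pt) \<Rightarrow> pt \<Rightarrow> phase set set" where
  "discont_partition V I F N \<omega> =
     {connected_component_set (regular_set V I F N \<omega>) p | p. p \<in> regular_set V I F N \<omega>}"

definition open_polygon :: "phase set \<Rightarrow> bool" where
  "open_polygon A \<longleftrightarrow>
     (\<exists>P v. A = P \<times> {v} \<and> P \<noteq> {} \<and> bounded P \<and> aff_dim P = 2 \<and> rel_interior P = P \<and>
        (\<exists>L. finite L \<and> rel_frontier P \<subseteq> (\<Union>(a, b)\<in>L. closed_segment a b)))"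

text \<open>A partition of S into polygons (atoms open, boundaries of measure zero).\<close>
definition polygon_partition :: "phase set \<Rightarrow> phase set set \<Rightarrow> bool" where
  "polygon_partition S U \<longleftrightarrow>
     finite U \<and> (\<forall>A\<in>U. open_polygon A \<and> A \<subseteq> S) \<and> pairwise disjnt U \<and>
     S \<subseteq> closure (\<Union>U)"

definition refines :: "'a set set \<Rightarrow> 'a set set \<Rightarrow> bool" where
  "refines U R \<longleftrightarrow> (\<forall>A\<in>U. \<exists>B\<in>R. A \<subseteq> B)"

fun iter_diff_ok :: "'a::real_normed_vector set \<Rightarrow> ('a \<Rightarrow> 'b::real_normed_vector) \<Rightarrow> 'a list \<Rightarrow> bool" where
  "iter_diff_ok W f [] = continuous_on W f"
| "iter_diff_ok W f (u # us) =
     (f differentiable_on W \<and> iter_diff_ok W (\<lambda>x. frechet_derivative f (at x) u) us)"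

definition smooth_on :: "'a::real_normed_vector set \<Rightarrow> ('a \<Rightarrow> 'b::real_normed_vector) \<Rightarrow> bool" where
  "smooth_on W f \<longleftrightarrow> open W \<and> (\<forall>us. iter_diff_ok W f us)"

definition gen_polygon_exchange :: "phase set \<Rightarrow> phase set set \<Rightarrow> (phase \<Rightarrow> phase) \<Rightarrow> bool" where
  "gen_polygon_exchange S R T \<longleftrightarrow>
     polygon_partition S R \<and>
     (\<forall>A\<in>R. (\<exists>g. homeomorphism A (T ` A) T g) \<and>
             (\<exists>W \<Phi>. A \<subseteq> W \<and> smooth_on W \<Phi> \<and> (\<forall>p\<in>A. \<Phi> p = T p))) \<and>
     (\<forall>A\<in>R. \<forall>B\<in>R. A \<noteq> B \<longrightarrow> T ` A \<inter> T ` B = {}) \<and>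
     polygon_partition S ((\<lambda>A. T ` A) ` R)"

definition join_atoms :: "('a \<Rightarrow> 'a) \<Rightarrow> 'a set set \<Rightarrow> nat \<Rightarrow> 'a set set" where
  "join_atoms T U n =
     {C. C \<noteq> {} \<and> (\<exists>f. (\<forall>k<n. f k \<in> U) \<and> C = {p. \<forall>k<n. (T ^^ k) p \<in> f k})}"

definition partition_entropy :: "('a \<Rightarrow> 'a) \<Rightarrow> 'a set set \<Rightarrow> ereal" where
  "partition_entropy T U =
     limsup (\<lambda>n. ereal (ln (real (card (join_atoms T U n))) / real n))"

definition poly_entropy :: "phase set \<Rightarrow> phase set set \<Rightarrow> (phase \<Rightarrow> phase) \<Rightarrow> ereal" where
  "poly_entropy S R T =
     (SUP U \<in> {U. polygon_partition S U \<and> refines U R}. partition_entropy T U)"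

end

theory Submission
  imports Defs
begin

text \<open>
  A trajectory that starts off the finitely many planes through edges and parallel to its direction
  meets the next face away from the edges, and nearby trajectories meet the same face; so on each
  component of the regular set the map is the projection along the direction between two face
  planes. Such planes cut each face into finitely many cells, whence finitely many polygons. The
  image is dense because a trajectory can be run backwards.

  For the entropy, let \<open>W\<close> be the finite set of normals of all planes that contain a boundary segment
  of an atom and are parallel to its direction, closed under the finite reflection group. For a phase
  point \<open>(x, v)\<close> and \<open>w \<in> W\<close> orthogonal to \<open>v\<close>, the coordinate \<open>w \<bullet> x\<close> is
  constant along the flight and a bounce only adds a constant to it and relabels \<open>w\<close>. Hence the
  atoms of the \<open>n\<close>-fold join are bounded by level sets of these coordinates at finitely many
  levels, and the map does not change coordinate distances. A set smaller than the gaps between the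
  levels for \<open>L\<close> steps is cut at most once per \<open>w\<close>, so into at most \<open>2 ^ card W\<close> codes of
  length \<open>L\<close>, and each piece stays small under the iteration. This bounds the entropy by
  \<open>card W * ln 2 / L\<close> for every \<open>L\<close>.
\<close>

section \<open>Planes, segments and polygons\<close>

text \<open>Many lines through one point would cut even a tiny set into many pieces, and under
  iteration this local multiplicity could grow with the number of steps. What prevents it is that
  reflections only permute the finite set \<open>W\<close>: longer blocks bring more levels but no
  new directions, so a set narrower than every gap is still crossed at most once per normal. The
  price is that the admissible size shrinks as \<open>L\<close> grows. This affects only the number
  of initial small sets, a constant with respect to \<open>n\<close>, which drops out of the growth
  rate before \<open>L\<close> tends to infinity. Atoms are open and omit their boundaries, so they
  are counted through codes of points whose orbits stay inside atoms. Such a code persists on a disc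
  of the face plane; hence it is also realised by a point on no level, for which all comparisons
  with levels are strict. Smallness is measured solely by coordinates orthogonal to the current
  direction, because only these are preserved by the flight.\<close>

lemma affine_hull_eq_hyperplane:
  fixes S :: "pt set"
  assumes "S \<subseteq> {x. n \<bullet> x = c}" "n \<noteq> 0" "aff_dim S = 2"
  shows "affine hull S = {x. n \<bullet> x = c}"
proof (rule affine_dim_equal)
  show "affine hull S \<subseteq> {x. n \<bullet> x = c}"
    by (rule hull_minimal[OF assms(1)]) (rule affine_hyperplane)
  show "affine hull S \<noteq> {}" using assms(3) by auto
  show "aff_dim (affine hull S) = aff_dim {x. n \<bullet> x = c}"
    using assms by (simp add: aff_dim_hyperplane)
qed (auto simp: affine_hyperplane)

lemma exists_normal_orthogonal_to_two:
  fixes v u :: pt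
  shows "\<exists>w. w \<noteq> 0 \<and> w \<bullet> v = 0 \<and> w \<bullet> u = 0"
proof -
  have "dim {v,u} \<le> card {v,u}" by (rule dim_le_card') simp
  also have "\<dots> \<le> 2" by (simp add: card_insert_if)
  finally have "dim {v,u} < DIM(pt)" by simp
  then obtain w where "w \<noteq> 0" "\<And>y. y \<in> span {v,u} \<Longrightarrow> orthogonal w y"
    using orthogonal_to_subspace_exists by blast
  then show ?thesis by (metis insertCI orthogonal_def span_base)
qed

text \<open>A plane transverse to \<open>v\<close> is contained in no plane parallel to
  \<open>v\<close>, so each plane of \<open>K\<close> meets it in a nowhere dense set. The induction
  leaves one plane at a time while staying in an open set that avoids the earlier ones.\<close>

lemma hyperplane_point_off_planes:
  fixes n v x :: pt
  assumes "finite K" "\<forall>(w,d)\<in>K. w \<noteq> 0 \<and> w \<bullet> v = 0" "n \<bullet> v \<noteq> 0" "e > 0"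
  shows "\<exists>y. n \<bullet> y = n \<bullet> x \<and> dist x y < e \<and> (\<forall>(w,d)\<in>K. w \<bullet> y \<noteq> d)"
  using assms(1,2)
proof (induction K)
  case empty
  show ?case using assms by (intro exI[of _ x]) auto
next
  case (insert k K)
  obtain w d where k: "k = (w,d)" by (cases k)
  have w: "w \<noteq> 0" "w \<bullet> v = 0" using insert.prems k by auto
  obtain y where y: "n \<bullet> y = n \<bullet> x" "dist x y < e" "\<forall>(w,d)\<in>K. w \<bullet> y \<noteq> d"
    using insert by auto
  show ?case
  proof (cases "w \<bullet> y = d")
    case False
    then show ?thesis using y k by (intro exI[of _ y]) auto
  next
    case True
    define O' where "O' = ball x e \<inter> (\<Inter>(w,d)\<in>K. {z. w \<bullet> z \<noteq> d})"
    have op: "open {z. w \<bullet> z \<noteq> d}" for w :: pt and d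
      using open_Compl[OF closed_hyperplane[of w d]] by (simp add: Collect_neg_eq)
    have "open O'" unfolding O'_def using insert.hyps op by (intro open_Int open_ball open_INT) auto
    moreover have "y \<in> O'" using y by (auto simp: O'_def)
    ultimately obtain r where r: "r > 0" "ball y r \<subseteq> O'" using open_contains_ball by blast
    \<comment> \<open>This is \<open>w\<close> projected along \<open>v\<close> onto the directions
      of the plane. As \<open>w\<close> is orthogonal to \<open>v\<close>, its product with
      \<open>w\<close> is still \<open>w \<bullet> w\<close>, so every step along it leaves the
      level \<open>d\<close>.\<close>
    define u where "u = w - ((w \<bullet> n) / (v \<bullet> n)) *\<^sub>R v"
    have un: "n \<bullet> u = 0" using assms(3)
      by (simp add: u_def inner_diff_right inner_commute)
    have uw: "w \<bullet> u > 0" using w by (simp add: u_def inner_diff_right)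
    then have u0: "u \<noteq> 0" by auto
    define z where "z = y + (r / (2 * norm u)) *\<^sub>R u"
    have "dist y z < r" using r u0 by (simp add: z_def dist_norm)
    then have "z \<in> O'" using r by auto
    moreover have "w \<bullet> z \<noteq> d" using uw r u0 True by (simp add: z_def inner_add_right)
    moreover have "n \<bullet> z = n \<bullet> x" using y un by (simp add: z_def inner_add_right)
    ultimately show ?thesis using k by (intro exI[of _ z]) (auto simp: O'_def)
  qed
qed

lemma collinear_transversal_planes:
  fixes n v w :: pt
  assumes "w \<noteq> 0" "w \<bullet> v = 0" "n \<bullet> v \<noteq> 0"
  shows "collinear ({x. n \<bullet> x = c} \<inter> {x. w \<bullet> x = d})"
proof -
  have n0: "n \<noteq> 0" using assms by auto
  have "\<exists>x. n \<bullet> x = c \<and> w \<bullet> x \<noteq> d"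
    using hyperplane_point_off_planes[of "{(w,d)}" v n 1 "(c / (n \<bullet> n)) *\<^sub>R n"] assms n0 by auto
  then have "\<not> {x. n \<bullet> x = c} \<subseteq> {x. w \<bullet> x = d}" by auto
  then show ?thesis unfolding collinear_aff_dim
    using n0 by (auto simp: aff_dim_affine_Int_hyperplane affine_hyperplane aff_dim_hyperplane)
qed

text \<open>\<open>B\<close> may be neither closed nor convex, so it is first enlarged to a ball; a
  nonempty compact convex subset of a line is a segment.\<close>

lemma bounded_transversal_planes_subset_segment:
  fixes n v w :: pt
  assumes "w \<noteq> 0" "w \<bullet> v = 0" "n \<bullet> v \<noteq> 0" "bounded B"
  shows "\<exists>a b. B \<inter> {x. n \<bullet> x = c} \<inter> {x. w \<bullet> x = d} \<subseteq> closed_segment a b"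
proof -
  obtain r where r: "B \<subseteq> cball 0 r" using bounded_subset_ballD[OF assms(4), of 0] ball_subset_cball by blast
  let ?T = "cball 0 r \<inter> ({x. n \<bullet> x = c} \<inter> {x. w \<bullet> x = d})"
  have "compact ?T" by (intro compact_Int_closed closed_Int closed_hyperplane) simp
  moreover have "convex ?T" by (intro convex_Int convex_hyperplane) simp
  moreover have "collinear ?T"
    using collinear_transversal_planes[OF assms(1-3), of c d] by (rule collinear_subset) auto
  ultimately obtain a b where "?T = {} \<or> ?T = closed_segment a b"
    using compact_convex_collinear_segment[of ?T] by metis
  then have "?T \<subseteq> closed_segment a b" by (metis empty_subsetI order_refl)
  moreover have "B \<inter> {x. n \<bullet> x = c} \<inter> {x. w \<bullet> x = d} \<subseteq> ?T" using r by auto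
  ultimately show ?thesis by (meson order_trans)
qed

text \<open>The edge condition of \<open>open_polygon\<close>, detached so that it can be assembled
  by finite unions and passed to subsets.\<close>

definition segment_covered :: "pt set \<Rightarrow> bool" where
  "segment_covered S \<longleftrightarrow> (\<exists>L. finite L \<and> S \<subseteq> (\<Union>(a, b)\<in>L. closed_segment a b))"

lemma segment_covered_subset: "segment_covered T \<Longrightarrow> S \<subseteq> T \<Longrightarrow> segment_covered S"
  unfolding segment_covered_def by (meson subset_trans)

lemma segment_covered_closed_segment: "segment_covered (closed_segment a b)"
  unfolding segment_covered_def by (intro exI[of _ "{(a,b)}"]) auto

lemma segment_covered_Un:
  assumes "segment_covered S" "segment_covered T"
  shows "segment_covered (S \<union> T)"
proof -
  obtain L M where "finite L" "S \<subseteq> (\<Union>(a, b)\<in>L. closed_segment a b)"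
    "finite M" "T \<subseteq> (\<Union>(a, b)\<in>M. closed_segment a b)"
    using assms unfolding segment_covered_def by blast
  then show ?thesis unfolding segment_covered_def by (intro exI[of _ "L \<union> M"]) auto
qed

lemma segment_covered_UN:
  assumes "finite J" "\<And>i. i \<in> J \<Longrightarrow> segment_covered (S i)"
  shows "segment_covered (\<Union>i\<in>J. S i)"
  using assms
proof (induction J)
  case empty
  then show ?case by (auto simp: segment_covered_def)
next
  case (insert j J)
  then show ?case by (simp add: segment_covered_Un)
qed

lemma segment_covered_rel_frontier_polygon:
  fixes q :: "pt set"
  assumes "finite X" "q = convex hull X" "aff_dim q = 2"
  shows "segment_covered (rel_frontier q)"
proof -
  have pq: "polytope q" using assms unfolding polytope_def by auto
  then have ph: "polyhedron q" by (rule polytope_imp_polyhedron)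
  have seg: "\<exists>p. f = closed_segment (fst p) (snd p)" if "f facet_of q" for f
  proof -
    have ff: "f face_of q" "f \<noteq> {}" "aff_dim f = 1" using that assms by (auto simp: facet_of_def)
    then have "polytope f" using pq face_of_polytope_polytope by blast
    then show ?thesis using ff compact_convex_collinear_segment[of f]
      by (auto simp: polytope_imp_compact polytope_imp_convex collinear_aff_dim)
  qed
  define s where "s f = (SOME p. f = closed_segment (fst p) (snd p))" for f :: "pt set"
  have s: "f = closed_segment (fst (s f)) (snd (s f))" if "f facet_of q" for f
    unfolding s_def using seg[OF that] by (rule someI_ex)
  show ?thesis unfolding segment_covered_def
  proof (intro exI conjI)
    show "finite (s ` {f. f facet_of q})" using finite_polyhedron_facets[OF ph] by simp
    show "rel_frontier q \<subseteq> (\<Union>(a, b)\<in>s ` {f. f facet_of q}. closed_segment a b)"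
    proof
      fix x assume "x \<in> rel_frontier q"
      then obtain f where f: "f facet_of q" "x \<in> f"
        using rel_frontier_of_polyhedron[OF ph] by auto
      then have "x \<in> closed_segment (fst (s f)) (snd (s f))" using s by blast
      then show "x \<in> (\<Union>(a, b)\<in>s ` {f. f facet_of q}. closed_segment a b)"
        using f(1) by (auto simp: case_prod_unfold)
    qed
  qed
qed

text \<open>A plane that contains a segment and is parallel to \<open>v\<close> contains every line
  in direction \<open>v\<close> meeting the segment, so missing an edge becomes a condition on the
  starting point. A normal exists also for a degenerate segment, since two vectors never span the
  space.\<close>

lemma segment_covered_parallel_planes:
  fixes v :: pt
  assumes "segment_covered S"
  shows "\<exists>K. finite K \<and> (\<forall>(w,d)\<in>K. w \<noteq> 0 \<and> w \<bullet> v = 0) \<and> (\<forall>x\<in>S. \<exists>(w,d)\<in>K. w \<bullet> x = d)"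
proof -
  obtain L where L: "finite L" "S \<subseteq> (\<Union>(a, b)\<in>L. closed_segment a b)"
    using assms unfolding segment_covered_def by blast
  obtain n where n: "\<And>u::pt. n u \<noteq> 0 \<and> n u \<bullet> v = 0 \<and> n u \<bullet> u = 0"
    using exists_normal_orthogonal_to_two by metis
  let ?K = "(\<lambda>(a,b). (n (b - a), n (b - a) \<bullet> a)) ` L"
  have "\<exists>(w,d)\<in>?K. w \<bullet> x = d" if x: "x \<in> S" for x
  proof -
    obtain a b where ab: "(a,b) \<in> L" "x \<in> closed_segment a b" using L x by blast
    then obtain u where "x = (1 - u) *\<^sub>R a + u *\<^sub>R b" by (auto simp: closed_segment_def)
    then have "x = a + u *\<^sub>R (b - a)" by (simp add: algebra_simps)
    then have "n (b - a) \<bullet> x = n (b - a) \<bullet> a" using n by (simp add: inner_add_right)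
    then show ?thesis using ab by force
  qed
  then show ?thesis using L n by (intro exI[of _ ?K]) auto
qed

text \<open>\<open>C\<close> meets the relative interior in a set that is open in \<open>C\<close>,
  and also closed because \<open>C\<close> avoids the relative frontier. This replaces convexity:
  faces may be non-convex, so a segment between two of their points could leave them.\<close>

lemma connected_subset_rel_open:
  fixes P :: "'a::euclidean_space set"
  assumes "connected C" "C \<subseteq> affine hull P" "x \<in> C" "x \<in> rel_interior P" "C \<inter> rel_frontier P = {}"
  shows "C \<subseteq> rel_interior P"
proof (rule ccontr)
  assume n: "\<not> C \<subseteq> rel_interior P"
  have o: "openin (top_of_set (affine hull P)) (rel_interior P)" by (rule openin_rel_interior)
  have 1: "openin (top_of_set C) (C \<inter> rel_interior P)"
  proof -
    obtain O' where "open O'" "rel_interior P = affine hull P \<inter> O'" using o by (auto simp: openin_open)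
    then have "C \<inter> rel_interior P = C \<inter> O'" using assms(2) by blast
    then show ?thesis using \<open>open O'\<close> by (metis openin_open)
  qed
  have "C \<inter> rel_interior P = C \<inter> closure P"
    using assms(5) rel_interior_subset[of P] closure_subset[of P] unfolding rel_frontier_def by blast
  then have 2: "closedin (top_of_set C) (C \<inter> rel_interior P)" by (simp add: closedin_closed_Int)
  show False using assms(1) 1 2 n assms(3,4) unfolding connected_clopen by blast
qed

lemma inner_reflect:
  assumes "norm n = 1"
  shows "reflect n x \<bullet> reflect n y = x \<bullet> y" "reflect n (reflect n x) = x" "n \<bullet> reflect n x = - (n \<bullet> x)"
proof -
  have n: "n \<bullet> n = 1" using assms by (simp add: norm_eq_1)
  show "reflect n x \<bullet> reflect n y = x \<bullet> y"
    using n by (simp add: reflect_def inner_diff_left inner_diff_right inner_commute)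
  show "n \<bullet> reflect n x = - (n \<bullet> x)"
    using n by (simp add: reflect_def inner_diff_right)
  then show "reflect n (reflect n x) = x"
    using n by (simp add: reflect_def inner_diff_right)
qed

text \<open>The direction \<open>v\<close> of the bounding planes and the phase direction
  \<open>u\<close> are kept apart: the image of an atom is bounded by planes parallel to the
  incoming direction but carries the reflected one.\<close>

lemma open_polygon_transversal:
  fixes P :: "pt set"
  assumes P: "P \<noteq> {}" "bounded P" "openin (top_of_set {x. n \<bullet> x = c}) P"
    and nv: "n \<bullet> v \<noteq> 0" and K: "finite K" "\<forall>(w,d)\<in>K. w \<noteq> 0 \<and> w \<bullet> v = 0"
    and fr: "\<And>x. x \<in> closure P - P \<Longrightarrow> \<exists>(w,d)\<in>K. w \<bullet> x = d"
  shows "open_polygon (P \<times> {u})"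
proof -
  have n0: "n \<noteq> 0" using nv by auto
  have sub: "P \<subseteq> {x. n \<bullet> x = c}" using P(3) openin_imp_subset by blast
  have dim: "aff_dim P = 2"
    using aff_dim_openin[OF P(3) affine_hyperplane P(1)] n0 by (simp add: aff_dim_hyperplane)
  have hull: "affine hull P = {x. n \<bullet> x = c}" using affine_hull_eq_hyperplane[OF sub n0 dim] .
  have ri: "rel_interior P = P" using P(3) hull by (simp add: rel_interior_eq)
  have cl: "closure P \<subseteq> {x. n \<bullet> x = c}" by (rule closure_minimal[OF sub closed_hyperplane])
  have "segment_covered (\<Union>k\<in>K. closure P \<inter> {x. n \<bullet> x = c} \<inter> {x. fst k \<bullet> x = snd k})"
  proof (rule segment_covered_UN[OF K(1)])
    fix k assume "k \<in> K"
    then have "fst k \<noteq> 0" "fst k \<bullet> v = 0" using K(2) by auto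
    then show "segment_covered (closure P \<inter> {x. n \<bullet> x = c} \<inter> {x. fst k \<bullet> x = snd k})"
      using bounded_transversal_planes_subset_segment[of "fst k" v n "closure P" c "snd k"] nv
        bounded_closure[OF P(2)] segment_covered_subset[OF segment_covered_closed_segment] by blast
  qed
  moreover have "rel_frontier P \<subseteq> (\<Union>k\<in>K. closure P \<inter> {x. n \<bullet> x = c} \<inter> {x. fst k \<bullet> x = snd k})"
    using fr cl by (fastforce simp: rel_frontier_def ri)
  ultimately have "segment_covered (rel_frontier P)" by (rule segment_covered_subset)
  then show ?thesis unfolding open_polygon_def segment_covered_def using P dim ri by blast
qed

lemma iter_diff_ok_const: "iter_diff_ok UNIV (\<lambda>x. c) us"
  by (induction us arbitrary: c) (auto simp: frechet_derivative_const)

text \<open>The first derivative in a fixed direction is already constant, so the recursion ends in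
  \<open>iter_diff_ok_const\<close>.\<close>

lemma smooth_on_affine:
  assumes "bounded_linear L"
  shows "smooth_on UNIV (\<lambda>x. L x + b)"
proof -
  have d: "((\<lambda>x. L x + b) has_derivative L) (at x)" for x
    using bounded_linear_imp_has_derivative[OF assms] by (auto intro!: derivative_eq_intros)
  have "iter_diff_ok UNIV (\<lambda>x. L x + b) us" for us
  proof (cases us)
    case Nil
    then show ?thesis using linear_continuous_on[OF assms] by (auto intro!: continuous_intros)
  next
    case (Cons u us')
    have "frechet_derivative (\<lambda>x. L x + b) (at x) = L" for x
      using frechet_derivative_at[OF d] by simp
    moreover have "(\<lambda>x. L x + b) differentiable_on UNIV"
      using d by (auto simp: differentiable_on_def differentiable_def)
    ultimately show ?thesis by (simp add: Cons iter_diff_ok_const)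
  qed
  then show ?thesis by (simp add: smooth_on_def)
qed

lemma finite_min_gap:
  fixes Z :: "real set"
  assumes "finite Z"
  shows "\<exists>\<delta>>0. \<forall>a\<in>Z. \<forall>b\<in>Z. a \<noteq> b \<longrightarrow> \<delta> \<le> \<bar>a - b\<bar>"
proof -
  \<comment> \<open>The extra 1 keeps the set nonempty when \<open>Z\<close> has fewer than two
    elements.\<close>
  let ?D = "insert 1 ((\<lambda>(a,b). \<bar>a - b\<bar>) ` {(a,b)\<in>Z \<times> Z. a \<noteq> b})"
  have "finite {(a,b)\<in>Z \<times> Z. a \<noteq> b}" using assms by (rule_tac finite_subset[of _ "Z \<times> Z"]) auto
  then have f: "finite ?D" by simp
  have "Min ?D > 0" using f by (subst Min_gr_iff) auto
  moreover have "Min ?D \<le> \<bar>a - b\<bar>" if "a \<in> Z" "b \<in> Z" "a \<noteq> b" for a b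
    using f that by (intro Min_le) force+
  ultimately show ?thesis by blast
qed

section \<open>Local geometry of the boundary\<close>

locale polytop_billiard =
  fixes V :: "pt set" and I :: "'i set" and F :: "'i \<Rightarrow> pt set" and N :: "'i \<Rightarrow> pt"
  assumes polytop: "polytop V I F N"
begin

text \<open>The choice of the point is immaterial, because differences of points of a face are
  orthogonal to its normal.\<close>

definition offset :: "'i \<Rightarrow> real" where
  "offset i = N i \<bullet> (SOME x. x \<in> F i)"

definition face_plane :: "'i \<Rightarrow> pt set" where
  "face_plane i = {x. N i \<bullet> x = offset i}"

text \<open>The points of a face at which departure and reflection are unambiguous, as demanded at
  both ends of the flight in \<open>regular_set\<close>.\<close>

definition face_core :: "'i \<Rightarrow> pt set" where
  "face_core i = rel_interior (F i) - (\<Union>k\<in>I-{i}. F k)"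

lemma finite_I: "finite I" and compact_V: "compact V"
  and closure_interior_V: "closure (interior V) = V"
  and frontier_V: "frontier V = (\<Union>i\<in>I. F i)"
  and norm_N: "i \<in> I \<Longrightarrow> norm (N i) = 1"
  and polygon_F: "i \<in> I \<Longrightarrow> closed_polygon (F i)"
  using polytop by (auto simp: polytop_def)

lemma N_nz: "i \<in> I \<Longrightarrow> N i \<noteq> 0"
  using norm_N by fastforce

lemma aff_dim_F: "i \<in> I \<Longrightarrow> aff_dim (F i) = 2"
  using polygon_F by (auto simp: closed_polygon_def)

lemma F_subset_plane: "i \<in> I \<Longrightarrow> F i \<subseteq> face_plane i"
proof
  fix x assume i: "i \<in> I" and x: "x \<in> F i"
  then have "(SOME x. x \<in> F i) \<in> F i" by (metis someI)
  then have "N i \<bullet> (x - (SOME x. x \<in> F i)) = 0" using i x polytop by (auto simp: polytop_def)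
  then show "x \<in> face_plane i" by (simp add: face_plane_def offset_def inner_diff_right)
qed

lemma affine_hull_F: "i \<in> I \<Longrightarrow> affine hull F i = face_plane i"
  using affine_hull_eq_hyperplane[of "F i" "N i" "offset i"] F_subset_plane aff_dim_F N_nz
  by (auto simp: face_plane_def)

lemma F_polygons:
  assumes "i \<in> I"
  obtains Q where "finite Q" "F i = \<Union>Q"
    "\<And>q. q \<in> Q \<Longrightarrow> \<exists>X. finite X \<and> q = convex hull X \<and> aff_dim q = 2"
    "\<And>q. q \<in> Q \<Longrightarrow> rel_interior q \<subseteq> rel_interior (F i)"
    "\<And>q. q \<in> Q \<Longrightarrow> closure (rel_interior q) = q"
proof -
  obtain Q where Q: "finite Q" "F i = \<Union>Q"
    "\<And>q. q \<in> Q \<Longrightarrow> \<exists>X. finite X \<and> q = convex hull X \<and> aff_dim q = 2"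
    using polygon_F[OF assms] by (auto simp: closed_polygon_def)
  have 1: "rel_interior q \<subseteq> rel_interior (F i)" if "q \<in> Q" for q
  proof (rule subset_rel_interior)
    show s: "q \<subseteq> F i" using that Q by auto
    have "affine hull q = face_plane i" unfolding face_plane_def
      by (rule affine_hull_eq_hyperplane)
        (use s F_subset_plane[OF assms] Q(3)[OF that] N_nz[OF assms] in \<open>auto simp: face_plane_def\<close>)
    then show "affine hull q = affine hull F i" using affine_hull_F[OF assms] by simp
  qed
  have 2: "closure (rel_interior q) = q" if "q \<in> Q" for q
  proof -
    obtain X where X: "finite X" "q = convex hull X" using Q(3)[OF \<open>q \<in> Q\<close>] by auto
    then have "compact q" by (simp add: finite_imp_compact_convex_hull)
    then show ?thesis using X convex_closure_rel_interior[of q] closure_closed[of q]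
      by (simp add: compact_imp_closed convex_convex_hull)
  qed
  show thesis using that[OF Q 1 2] by blast
qed

lemma compact_F: "i \<in> I \<Longrightarrow> compact (F i)"
proof -
  assume i: "i \<in> I"
  obtain Q where "finite Q" "F i = \<Union>Q"
    "\<And>q. q \<in> Q \<Longrightarrow> \<exists>X. finite X \<and> q = convex hull X \<and> aff_dim q = 2" using F_polygons[OF i] by metis
  then show ?thesis using finite_imp_compact_convex_hull by (metis compact_Union)
qed

lemma closed_F: "i \<in> I \<Longrightarrow> closed (F i)"
  by (simp add: compact_F compact_imp_closed)

lemma F_subset_closure_rel_interior: "i \<in> I \<Longrightarrow> F i \<subseteq> closure (rel_interior (F i))"
proof
  fix x assume i: "i \<in> I" and x: "x \<in> F i"
  obtain Q where Q: "F i = \<Union>Q"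
    "\<And>q. q \<in> Q \<Longrightarrow> rel_interior q \<subseteq> rel_interior (F i)"
    "\<And>q. q \<in> Q \<Longrightarrow> closure (rel_interior q) = q" using F_polygons[OF i] by metis
  then obtain q where "q \<in> Q" "x \<in> q" using x by auto
  then show "x \<in> closure (rel_interior (F i))" using Q closure_mono by blast
qed

lemma rel_interior_F_ball:
  assumes "i \<in> I" "x \<in> rel_interior (F i)"
  shows "\<exists>e>0. ball x e \<inter> face_plane i \<subseteq> rel_interior (F i)"
proof -
  have "openin (top_of_set (face_plane i)) (rel_interior (F i))"
    using openin_rel_interior[of "F i"] affine_hull_F[OF assms(1)] by simp
  then show ?thesis using assms(2) by (meson openin_contains_ball)
qed

lemma rel_interior_face_disjoint:
  "i \<in> I \<Longrightarrow> j \<in> I \<Longrightarrow> i \<noteq> j \<Longrightarrow> rel_interior (F i) \<inter> rel_interior (F j) = {}"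
  using polytop by (auto simp: polytop_def)

text \<open>For unit normals the inequality says that the planes are not parallel. If they were, the
  common point would make them coincide; \<open>F k\<close> lies in the closure of its relative
  interior, which would then enter the relative interior of \<open>F i\<close> near
  \<open>x\<close>, against their disjointness.\<close>

lemma faces_transversal:
  assumes "i \<in> I" "k \<in> I" "i \<noteq> k" "x \<in> rel_interior (F i)" "x \<in> F k"
  shows "(N k \<bullet> N i)\<^sup>2 \<noteq> 1"
proof
  assume h: "(N k \<bullet> N i)\<^sup>2 = 1"
  let ?s = "N k \<bullet> N i"
  have n: "N i \<bullet> N i = 1" "N k \<bullet> N k = 1" using norm_N assms by (auto simp: norm_eq_1)
  have "(N i - ?s *\<^sub>R N k) \<bullet> (N i - ?s *\<^sub>R N k) = 0"
    using n h by (simp add: inner_diff_left inner_diff_right inner_commute power2_eq_square)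
  then have e: "N i = ?s *\<^sub>R N k" by simp
  have xk: "x \<in> face_plane k" using assms F_subset_plane by blast
  have xi: "x \<in> face_plane i" using assms F_subset_plane rel_interior_subset by blast
  have oi: "offset i = ?s * offset k"
  proof -
    have "offset i = N i \<bullet> x" using xi by (simp add: face_plane_def)
    also have "\<dots> = ?s * (N k \<bullet> x)" by (subst e) simp
    finally show ?thesis using xk by (simp add: face_plane_def)
  qed
  have sub: "face_plane k \<subseteq> face_plane i"
  proof
    fix y assume "y \<in> face_plane k"
    then have "N k \<bullet> y = offset k" by (simp add: face_plane_def)
    moreover have "N i \<bullet> y = ?s * (N k \<bullet> y)" by (subst e) simp
    ultimately show "y \<in> face_plane i" using oi by (simp add: face_plane_def)
  qed
  obtain r where r: "r > 0" "ball x r \<inter> face_plane i \<subseteq> rel_interior (F i)"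
    using rel_interior_F_ball assms by blast
  have "x \<in> closure (rel_interior (F k))" using F_subset_closure_rel_interior assms by blast
  then obtain z where z: "z \<in> rel_interior (F k)" "dist z x < r"
    using r(1) closure_approachable by blast
  then have "z \<in> face_plane i" using sub F_subset_plane[of k] assms rel_interior_subset by blast
  then have "z \<in> rel_interior (F i)" using r z by (auto simp: dist_commute)
  then show False using rel_interior_face_disjoint assms z by blast
qed

text \<open>Points outside the core arise in two ways: on the relative frontier of the face, which
  is covered by edges of its convex pieces, or where another face touches its relative interior,
  which by transversality happens along a line.\<close>

lemma segment_covered_face_edges: "segment_covered (\<Union>i\<in>I. F i - face_core i)"
proof (rule segment_covered_UN[OF finite_I])
  fix i assume i: "i \<in> I"
  obtain Q where Q: "finite Q" "F i = \<Union>Q"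
    "\<And>q. q \<in> Q \<Longrightarrow> \<exists>X. finite X \<and> q = convex hull X \<and> aff_dim q = 2"
    "\<And>q. q \<in> Q \<Longrightarrow> rel_interior q \<subseteq> rel_interior (F i)"
    using F_polygons[OF i] by metis
  have "segment_covered (\<Union>q\<in>Q. rel_frontier q)"
    using Q(1,3) segment_covered_rel_frontier_polygon by (intro segment_covered_UN) blast+
  moreover have "F i - rel_interior (F i) \<subseteq> (\<Union>q\<in>Q. rel_frontier q)"
    using Q(2,4) closure_subset by (fastforce simp: rel_frontier_def)
  ultimately have fr: "segment_covered (F i - rel_interior (F i))"
    by (rule segment_covered_subset)
  have cr: "segment_covered (rel_interior (F i) \<inter> F k)" if k: "k \<in> I - {i}" for k
  proof (cases "rel_interior (F i) \<inter> F k = {}")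
    case True
    then show ?thesis by (simp add: segment_covered_subset[OF segment_covered_closed_segment])
  next
    case False
    then have t: "(N k \<bullet> N i)\<^sup>2 \<noteq> 1" using faces_transversal i k by blast
    have n: "N i \<bullet> N i = 1" "N k \<bullet> N k = 1" using norm_N i k by (auto simp: norm_eq_1)
    \<comment> \<open>A direction inside the plane of \<open>k\<close> that crosses the plane of
      \<open>i\<close>; only its existence matters, to apply the segment lemma to the two
      planes.\<close>
    define v where "v = N i - (N k \<bullet> N i) *\<^sub>R N k"
    have v: "N k \<bullet> v = 0" "N i \<bullet> v \<noteq> 0"
      using n t by (auto simp: v_def inner_diff_right inner_commute power2_eq_square)
    have "bounded (F i)" "N k \<noteq> 0" using compact_F i k compact_imp_bounded N_nz by auto
    then obtain a b where ab: "F i \<inter> {x. N i \<bullet> x = offset i} \<inter> {x. N k \<bullet> x = offset k} \<subseteq> closed_segment a b"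
      using bounded_transversal_planes_subset_segment[of "N k" v "N i" "F i"] v by blast
    have "rel_interior (F i) \<inter> F k \<subseteq> F i \<inter> face_plane i \<inter> face_plane k"
      using F_subset_plane[of i] F_subset_plane[of k] i k rel_interior_subset by blast
    then have "rel_interior (F i) \<inter> F k \<subseteq> closed_segment a b" using ab
      unfolding face_plane_def by blast
    then show ?thesis using segment_covered_subset segment_covered_closed_segment by blast
  qed
  have "segment_covered (\<Union>k\<in>I-{i}. rel_interior (F i) \<inter> F k)"
    using finite_I cr by (intro segment_covered_UN) auto
  then have "segment_covered ((F i - rel_interior (F i)) \<union> (\<Union>k\<in>I-{i}. rel_interior (F i) \<inter> F k))"
    using fr segment_covered_Un by blast
  then show "segment_covered (F i - face_core i)"
    by (rule segment_covered_subset) (auto simp: face_core_def)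
qed

lemma face_core_subset: "face_core i \<subseteq> F i"
  using rel_interior_subset by (auto simp: face_core_def)

lemma face_core_plane: "i \<in> I \<Longrightarrow> x \<in> face_core i \<Longrightarrow> N i \<bullet> x = offset i"
  using F_subset_plane face_core_subset by (fastforce simp: face_plane_def)

lemma face_core_frontier: "i \<in> I \<Longrightarrow> x \<in> face_core i \<Longrightarrow> x \<in> frontier V"
  using face_core_subset frontier_V by blast

lemma face_core_not_interior: "i \<in> I \<Longrightarrow> x \<in> face_core i \<Longrightarrow> x \<notin> interior V"
  using face_core_frontier by (auto simp: frontier_def)

lemma face_core_index_unique:
  "i \<in> I \<Longrightarrow> j \<in> I \<Longrightarrow> x \<in> face_core i \<Longrightarrow> x \<in> F j \<Longrightarrow> i = j"
  by (auto simp: face_core_def)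

text \<open>The definition of \<open>polytop\<close> describes only points on the normal line. Once
  the ball is small enough to miss the other faces, each open half ball is connected and avoids the
  frontier, so one such point decides for the whole half.\<close>

lemma face_core_local:
  assumes i: "i \<in> I" and x: "x \<in> face_core i"
  obtains e where "e > 0" "ball x e \<inter> face_plane i \<subseteq> face_core i"
    "ball x e \<inter> frontier V \<subseteq> face_core i"
    "\<And>y. y \<in> ball x e \<Longrightarrow> N i \<bullet> y > offset i \<Longrightarrow> y \<in> interior V"
    "\<And>y. y \<in> ball x e \<Longrightarrow> N i \<bullet> y < offset i \<Longrightarrow> y \<notin> V"
proof -
  have x': "x \<in> rel_interior (F i)" using x by (auto simp: face_core_def)
  obtain e1 where e1: "e1 > 0" "ball x e1 \<inter> face_plane i \<subseteq> rel_interior (F i)"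
    using rel_interior_F_ball[OF i x'] by blast
  have "open (- (\<Union>k\<in>I-{i}. F k))" using finite_I closed_F by (intro open_Compl closed_UN) auto
  moreover have "x \<in> - (\<Union>k\<in>I-{i}. F k)" using x by (auto simp: face_core_def)
  ultimately obtain e2 where e2: "e2 > 0" "ball x e2 \<subseteq> - (\<Union>k\<in>I-{i}. F k)"
    by (rule openE)
  obtain e3 where e3: "e3 > 0" "\<And>t. 0 < t \<Longrightarrow> t < e3 \<Longrightarrow> x + t *\<^sub>R N i \<in> interior V \<and> x - t *\<^sub>R N i \<notin> V"
  proof -
    have "\<forall>x\<in>rel_interior (F i) - (\<Union>k\<in>I-{i}. F k). \<exists>e>0. \<forall>t. 0 < t \<and> t < e \<longrightarrow>
        x + t *\<^sub>R N i \<in> interior V \<and> x - t *\<^sub>R N i \<notin> V"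
      using polytop i unfolding polytop_def by blast
    from bspec[OF this x[unfolded face_core_def]] show thesis using that by blast
  qed
  define e where "e = min e1 e2"
  define t where "t = min (e/2) (e3/2)"
  have e: "e > 0" using e1 e2 by (simp add: e_def)
  have t: "0 < t" "t < e" "t < e3" using e e3(1) by (auto simp: t_def min_def)
  have pl: "ball x e \<inter> face_plane i \<subseteq> face_core i"
    using e1 e2 by (auto simp: e_def face_core_def)
  have fr: "ball x e \<inter> frontier V \<subseteq> face_plane i"
  proof
    fix y assume y: "y \<in> ball x e \<inter> frontier V"
    then obtain k where k: "k \<in> I" "y \<in> F k" using frontier_V by auto
    have "y \<in> ball x e2" using y by (auto simp: e_def)
    then have "k = i" using e2(2) k by blast
    then show "y \<in> face_plane i" using k F_subset_plane by blast
  qed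
  have tx: "N i \<bullet> x = offset i" using face_core_plane[OF i x] .
  have nn: "N i \<bullet> N i = 1" using norm_N[OF i] by (simp add: norm_eq_1)
  have up: "y \<in> interior V" if y: "y \<in> ball x e" "N i \<bullet> y > offset i" for y
  proof -
    let ?C = "ball x e \<inter> {y. N i \<bullet> y > offset i}"
    have c: "connected ?C" by (intro convex_connected convex_Int convex_halfspace_gt) simp
    have d: "?C \<inter> frontier V = {}" using fr by (auto simp: face_plane_def)
    have "x + t *\<^sub>R N i \<in> ?C" using t tx nn norm_N[OF i] by (simp add: dist_norm inner_add_right)
    moreover have "x + t *\<^sub>R N i \<in> V" using e3 t interior_subset by blast
    ultimately have "?C \<subseteq> V" using connected_Int_frontier[OF c, of V] d by blast
    then have "y \<in> V" "y \<notin> frontier V" using y d by auto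
    then show ?thesis using closure_subset by (auto simp: frontier_def)
  qed
  have lo: "y \<notin> V" if y: "y \<in> ball x e" "N i \<bullet> y < offset i" for y
  proof -
    let ?C = "ball x e \<inter> {y. N i \<bullet> y < offset i}"
    have c: "connected ?C" by (intro convex_connected convex_Int convex_halfspace_lt) simp
    have d: "?C \<inter> frontier V = {}" using fr by (auto simp: face_plane_def)
    have "x - t *\<^sub>R N i \<in> ?C" using t tx nn norm_N[OF i] by (simp add: dist_norm inner_diff_right)
    moreover have "x - t *\<^sub>R N i \<notin> V" using e3 t by blast
    ultimately have "?C \<inter> V = {}" using connected_Int_frontier[OF c, of V] d by blast
    then show ?thesis using y by auto
  qed
  show thesis using that[OF e pl _ up lo] pl fr by blast
qed


section \<open>Chords\<close>

text \<open>The endpoints are only required to lie outside the interior: this makes the relation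
  symmetric under reversal of time and still determines the exit point.\<close>

definition chord :: "pt \<Rightarrow> pt \<Rightarrow> pt \<Rightarrow> bool" where
  "chord v x y \<longleftrightarrow> x \<notin> interior V \<and> y \<notin> interior V \<and>
     (\<exists>t>0. y = x + t *\<^sub>R v \<and> (\<forall>s. 0 < s \<and> s < t \<longrightarrow> x + s *\<^sub>R v \<in> interior V))"

lemma chord_hit_point:
  assumes "chord v x y"
  shows "hit_point V x v = y"
proof -
  obtain t where t: "t > 0" "y = x + t *\<^sub>R v" "\<And>s. 0 < s \<Longrightarrow> s < t \<Longrightarrow> x + s *\<^sub>R v \<in> interior V"
    "y \<notin> interior V" using assms by (auto simp: chord_def)
  have "Inf {s. s > 0 \<and> x + s *\<^sub>R v \<notin> interior V} = t"
    by (rule cInf_eq_minimum) (use t in \<open>auto simp: not_less[symmetric]\<close>)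
  then show ?thesis using t by (simp add: hit_point_def exit_time_def)
qed

lemma chord_reverse:
  assumes "chord v x y"
  shows "chord (- v) y x"
proof -
  obtain t where t: "t > 0" "y = x + t *\<^sub>R v" "\<And>s. 0 < s \<Longrightarrow> s < t \<Longrightarrow> x + s *\<^sub>R v \<in> interior V"
    using assms by (auto simp: chord_def)
  have "y + s *\<^sub>R (- v) \<in> interior V" if "0 < s" "s < t" for s
    using t(3)[of "t - s"] that t(2) by (simp add: algebra_simps)
  moreover have "x = y + t *\<^sub>R (- v)" using t(2) by simp
  ultimately show ?thesis using assms t(1) unfolding chord_def by blast
qed

text \<open>Just before arrival the flight is in the interior, whereas a velocity tangent to the
  face or pointing inward would put that earlier point on the face or behind it.\<close>

lemma chord_arrival:
  assumes c: "chord v x y" and j: "j \<in> I" "y \<in> face_core j"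
  shows "N j \<bullet> v < 0"
proof (rule ccontr)
  assume n: "\<not> N j \<bullet> v < 0"
  obtain t where t: "t > 0" "y = x + t *\<^sub>R v" "\<And>s. 0 < s \<Longrightarrow> s < t \<Longrightarrow> x + s *\<^sub>R v \<in> interior V"
    using c by (auto simp: chord_def)
  obtain e where e: "e > 0" "ball y e \<inter> face_plane j \<subseteq> face_core j"
    "\<And>z. z \<in> ball y e \<Longrightarrow> N j \<bullet> z < offset j \<Longrightarrow> z \<notin> V"
    using face_core_local[OF j] by metis
  \<comment> \<open>Short enough to stay on the chord and within \<open>e\<close> of
    \<open>y\<close>; the \<open>+ 1\<close> spares a separate case for
    \<open>v = 0\<close>.\<close>
  define r where "r = min (t/2) (e / (2 * (norm v + 1)))"
  have nv: "norm v + 1 > 0" by (simp add: add_nonneg_pos)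
  have r: "0 < r" "r < t" using t e nv by (auto simp: r_def intro: min.strict_coboundedI1)
  have "r * norm v \<le> (e / (2 * (norm v + 1))) * (norm v + 1)"
    by (intro mult_mono) (use e nv in \<open>auto simp: r_def\<close>)
  also have "\<dots> = e / 2" using nv by (simp add: field_simps)
  finally have rv: "r * norm v < e" using e(1) by simp
  let ?z = "y - r *\<^sub>R v"
  have zi: "?z \<in> interior V" using t(3)[of "t - r"] r t(2) by (simp add: algebra_simps)
  have zb: "?z \<in> ball y e" using rv r by (simp add: dist_norm)
  have yz: "N j \<bullet> ?z = offset j - r * (N j \<bullet> v)"
    using face_core_plane[OF j] by (simp add: inner_diff_right)
  show False
  proof (cases "N j \<bullet> v = 0")
    case True
    then have "?z \<in> face_core j" using e(2) zb yz by (auto simp: face_plane_def)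
    then show False using face_core_not_interior j zi by blast
  next
    case False
    then have "N j \<bullet> ?z < offset j" using n r yz by (simp add: mult_pos_pos)
    then show False using e(3) zb zi interior_subset by blast
  qed
qed

lemma chord_departure:
  assumes "chord v x y" "i \<in> I" "x \<in> face_core i"
  shows "N i \<bullet> v > 0"
  using chord_arrival[OF chord_reverse[OF assms(1)] assms(2,3)] by simp

text \<open>The exit time is attained: the set of times outside the interior is nonempty because
  \<open>V\<close> is bounded, and bounded away from 0 because the ray first runs through a half
  ball. The endpoint is a limit of interior points, hence on the frontier.\<close>

lemma chord_exists:
  assumes i: "i \<in> I" "x \<in> face_core i" and v: "N i \<bullet> v > 0"
  shows "\<exists>y\<in>frontier V. chord v x y"
proof -
  define S where "S = {t. t > 0 \<and> x + t *\<^sub>R v \<notin> interior V}"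
  have v0: "v \<noteq> 0" using v by auto
  obtain e where e: "e > 0" "\<And>z. z \<in> ball x e \<Longrightarrow> N i \<bullet> z > offset i \<Longrightarrow> z \<in> interior V"
    using face_core_local[OF i] by metis
  have small: "x + s *\<^sub>R v \<in> interior V" if s: "0 < s" "s < e / norm v" for s
  proof (rule e(2))
    show "x + s *\<^sub>R v \<in> ball x e" using s v0 by (simp add: dist_norm field_simps)
    show "offset i < N i \<bullet> (x + s *\<^sub>R v)"
      using s v face_core_plane[OF i] by (simp add: inner_add_right)
  qed
  have lb: "e / norm v \<le> s" if "s \<in> S" for s
    using that small[of s] by (force simp: S_def not_less[symmetric])
  have "S \<noteq> {}"
  proof -
    obtain r where r: "\<And>z. z \<in> V \<Longrightarrow> norm z \<le> r"
      using compact_V compact_imp_bounded bounded_iff by metis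
    define t where "t = (\<bar>r\<bar> + norm x + 1) / norm v"
    have t: "t > 0" using v0 by (simp add: t_def add_nonneg_pos)
    have "t * norm v = \<bar>r\<bar> + norm x + 1" using v0 by (simp add: t_def)
    moreover have "norm (t *\<^sub>R v) \<le> norm (x + t *\<^sub>R v) + norm x"
      using norm_triangle_ineq4[of "x + t *\<^sub>R v" x] by simp
    ultimately have "norm (x + t *\<^sub>R v) > r" using t by simp
    then have "x + t *\<^sub>R v \<notin> V" using r by force
    then show ?thesis using t interior_subset by (auto simp: S_def)
  qed
  define t where "t = Inf S"
  have bb: "bdd_below S" using lb by (meson bdd_belowI)
  have te: "e / norm v \<le> t" unfolding t_def using \<open>S \<noteq> {}\<close> lb by (meson cInf_greatest)
  then have t0: "t > 0" using e v0 by (meson divide_pos_pos less_le_trans zero_less_norm_iff)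
  have "closed {s. x + s *\<^sub>R v \<notin> interior V}"
  proof -
    have "closed ((\<lambda>s. x + s *\<^sub>R v) -` (- interior V))"
      by (intro continuous_closed_vimage) (auto intro!: continuous_intros)
    then show ?thesis by (simp add: vimage_def)
  qed
  \<comment> \<open>Positivity is not a closed condition; the lower bound from the half ball
    replaces it and makes the set closed.\<close>
  moreover have "S = {s. x + s *\<^sub>R v \<notin> interior V} \<inter> {e / norm v..}"
    using lb e v0 by (auto simp: S_def intro: less_le_trans[of 0 "e / norm v"])
  ultimately have "closed S" by (simp add: closed_Int)
  then have tS: "t \<in> S" unfolding t_def using \<open>S \<noteq> {}\<close> bb closed_contains_Inf by blast
  have int: "x + s *\<^sub>R v \<in> interior V" if "0 < s" "s < t" for s
  proof (rule ccontr)
    assume "x + s *\<^sub>R v \<notin> interior V"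
    then have "s \<in> S" using that by (simp add: S_def)
    then show False using cInf_lower[OF _ bb] that(2) by (force simp: t_def)
  qed
  let ?y = "x + t *\<^sub>R v"
  have "((\<lambda>s. x + s *\<^sub>R v) \<longlongrightarrow> ?y) (at_left t)" by (intro tendsto_intros)
  moreover have "\<forall>\<^sub>F s in at_left t. x + s *\<^sub>R v \<in> closure (interior V)"
    using eventually_at_left_real[OF t0] by eventually_elim (use int closure_subset in auto)
  ultimately have "?y \<in> closure (interior V)"
    by (intro Lim_in_closed_set[of "closure (interior V)" _ "at_left t"]) auto
  then have "?y \<in> V" using closure_interior_V by simp
  then have "?y \<in> frontier V" using tS closure_subset by (auto simp: frontier_def S_def)
  moreover have "chord v x ?y"
    using t0 int tS face_core_not_interior[OF i] by (auto simp: chord_def S_def)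
  ultimately show ?thesis by blast
qed

text \<open>The shear agrees on the plane of face \<open>i\<close> with the projection along \<open>v\<close> onto the plane of
  face \<open>j\<close>; the second summand of the coefficient makes it an affine bijection of the whole space.\<close>
definition shear :: "'i \<Rightarrow> 'i \<Rightarrow> pt \<Rightarrow> pt \<Rightarrow> pt" where
  "shear i j v x = x + ((offset j - N j \<bullet> x) / (N j \<bullet> v) + (N i \<bullet> x - offset i) / (N i \<bullet> v)) *\<^sub>R v"

text \<open>The coefficient of \<open>v\<close> is unchanged by translation along \<open>v\<close>
  and changes sign when the faces are exchanged.\<close>

lemma shear_inverse:
  assumes "N i \<bullet> v \<noteq> 0" "N j \<bullet> v \<noteq> 0"
  shows "shear j i v (shear i j v x) = x"
proof -
  define c where "c = (offset j - N j \<bullet> x) / (N j \<bullet> v) + (N i \<bullet> x - offset i) / (N i \<bullet> v)"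
  have "(offset i - N i \<bullet> (x + c *\<^sub>R v)) / (N i \<bullet> v) + (N j \<bullet> (x + c *\<^sub>R v) - offset j) / (N j \<bullet> v) = - c"
    unfolding c_def using assms by (simp add: inner_add_right divide_simps algebra_simps)
  then have "shear j i v (x + c *\<^sub>R v) = (x + c *\<^sub>R v) + (- c) *\<^sub>R v"
    unfolding shear_def by presburger
  then show ?thesis unfolding shear_def[of i j] c_def[symmetric] by simp
qed

lemma shear_on_plane:
  "x \<in> face_plane i \<Longrightarrow> shear i j v x = x + ((offset j - N j \<bullet> x) / (N j \<bullet> v)) *\<^sub>R v"
  by (simp add: shear_def face_plane_def)

lemma chord_shear:
  assumes "i \<in> I" "j \<in> I" "chord v x y" "x \<in> face_core i" "y \<in> face_core j"
  shows "y = shear i j v x"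
proof -
  obtain t where t: "y = x + t *\<^sub>R v" using assms by (auto simp: chord_def)
  have "N j \<bullet> v \<noteq> 0" using chord_arrival assms by force
  moreover have "N j \<bullet> x + t * (N j \<bullet> v) = offset j"
    using face_core_plane[of j y] assms t by (simp add: inner_add_right)
  ultimately have "t = (offset j - N j \<bullet> x) / (N j \<bullet> v)" by (simp add: field_simps)
  then show ?thesis using shear_on_plane[of x i j v] face_core_plane[of i x] assms t
    by (simp add: face_plane_def)
qed

text \<open>The middle of the flight is a compact subset of the interior and tolerates a small
  shift. Towards both ends the distance to the boundary tends to 0, so there the half balls at the
  cores take over.\<close>

lemma chord_open:
  assumes i: "i \<in> I" "x \<in> face_core i" and j: "j \<in> I" "y \<in> face_core j" and c: "chord v x y"
  shows "\<exists>e>0. \<forall>x'\<in>ball x e \<inter> face_plane i.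
     x' \<in> face_core i \<and> shear i j v x' \<in> face_core j \<and> chord v x' (shear i j v x')"
proof -
  obtain t where t: "t > 0" "y = x + t *\<^sub>R v" "\<And>s. 0 < s \<Longrightarrow> s < t \<Longrightarrow> x + s *\<^sub>R v \<in> interior V"
    using c by (auto simp: chord_def)
  have vj: "N j \<bullet> v < 0" using chord_arrival c j by blast
  have vi: "N i \<bullet> v > 0" using chord_departure c i by blast
  then have v0: "norm v > 0" by auto
  obtain ex where ex: "ex > 0" "ball x ex \<inter> face_plane i \<subseteq> face_core i"
    "\<And>z. z \<in> ball x ex \<Longrightarrow> N i \<bullet> z > offset i \<Longrightarrow> z \<in> interior V"
    using face_core_local[OF i] by metis
  obtain ey where ey: "ey > 0" "ball y ey \<inter> face_plane j \<subseteq> face_core j"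
    "\<And>z. z \<in> ball y ey \<Longrightarrow> N j \<bullet> z > offset j \<Longrightarrow> z \<in> interior V"
    using face_core_local[OF j] by metis
  \<comment> \<open>The end pieces of length \<open>k * norm v\<close> take at most half of each
    radius, leaving the other half for the displacement of the starting point; \<open>t/3\<close>
    keeps the middle interval nonempty.\<close>
  define k where "k = min (t/3) (min ex ey / (2 * norm v))"
  have k: "0 < k" "k < t / 2" using t ex ey v0 by (auto simp: k_def min_def)
  have "k * norm v \<le> (min ex ey / (2 * norm v)) * norm v"
    using v0 by (intro mult_right_mono) (auto simp: k_def)
  then have kv: "k * norm v \<le> ex / 2" "k * norm v \<le> ey / 2"
    using v0 by (auto simp: min_def split: if_splits)
  let ?K = "(\<lambda>s. x + s *\<^sub>R v) ` {k..t-k}"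
  have "compact ?K" by (intro compact_continuous_image continuous_intros compact_Icc)
  moreover have "?K \<subseteq> interior V" using t(3) k by auto
  ultimately obtain e0 where e0: "e0 > 0" "(\<Union>z\<in>?K. cball z e0) \<subseteq> interior V"
    using compact_subset_open_imp_cball_epsilon_subset[OF _ open_interior] by metis
  \<comment> \<open>Flight time from \<open>z\<close> to the plane of face \<open>j\<close>. By
    continuity it changes by less than \<open>k\<close>, so the last piece still ends in the ball
    around \<open>y\<close>.\<close>
  define \<tau> where "\<tau> z = (offset j - N j \<bullet> z) / (N j \<bullet> v)" for z
  have "isCont \<tau> x" unfolding \<tau>_def using vj by (intro continuous_intros) auto
  moreover have "\<tau> x = t"
    using face_core_plane[OF j] t(2) vj by (simp add: \<tau>_def inner_add_right field_simps)
  ultimately obtain e1 where e1: "e1 > 0" "\<And>z. dist z x < e1 \<Longrightarrow> dist (\<tau> z) t < k"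
    using k(1) unfolding continuous_at_eps_delta by (metis dist_commute)
  define e where "e = min (min (ex/2) (ey/2)) (min e0 e1)"
  have e: "e > 0" "e \<le> ex/2" "e \<le> ey/2" "e \<le> e0" "e \<le> e1" using ex ey e0 e1 by (auto simp: e_def)
  have "x' \<in> face_core i \<and> shear i j v x' \<in> face_core j \<and> chord v x' (shear i j v x')"
    if x': "x' \<in> ball x e" "x' \<in> face_plane i" for x'
  proof -
    have d: "norm (x' - x) < e" using x' by (simp add: dist_norm norm_minus_commute)
    have tk: "\<bar>\<tau> x' - t\<bar> < k" using e1(2)[of x'] d e by (simp add: dist_norm)
    have near: "x' + s *\<^sub>R v \<in> ball (x + s0 *\<^sub>R v) r" if "\<bar>s - s0\<bar> \<le> k" "e + k * norm v \<le> r" for s s0 r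
    proof -
      have "norm (x' + s *\<^sub>R v - (x + s0 *\<^sub>R v)) \<le> norm (x' - x) + norm ((s - s0) *\<^sub>R v)"
        using norm_triangle_ineq[of "x' - x" "(s - s0) *\<^sub>R v"] by (simp add: algebra_simps)
      also have "norm ((s - s0) *\<^sub>R v) \<le> k * norm v" using that(1) by (simp add: mult_right_mono)
      finally show ?thesis using d that(2) by (simp add: dist_norm norm_minus_commute)
    qed
    have core: "x' \<in> face_core i" using ex(2) x' e ex(1) by auto
    have pl: "N i \<bullet> x' = offset i" using x' by (simp add: face_plane_def)
    have int: "x' + s *\<^sub>R v \<in> interior V" if s: "0 < s" "s < \<tau> x'" for s
    proof -
      consider "s \<le> k" | "k \<le> s" "s \<le> t - k" | "t - k \<le> s" by linarith
      then show ?thesis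
      proof cases
        case 1
        show ?thesis
        proof (rule ex(3))
          show "x' + s *\<^sub>R v \<in> ball x ex" using near[of s 0 ex] 1 s e kv by simp
          show "offset i < N i \<bullet> (x' + s *\<^sub>R v)" using pl s vi by (simp add: inner_add_right)
        qed
      next
        case 2
        have "x' + s *\<^sub>R v \<in> cball (x + s *\<^sub>R v) e0"
          using d e by (simp add: dist_norm norm_minus_commute)
        moreover have "x + s *\<^sub>R v \<in> ?K" using 2 by (intro imageI) simp
        ultimately show ?thesis using e0(2) by blast
      next
        case 3
        show ?thesis
        proof (rule ey(3))
          have "\<bar>s - t\<bar> \<le> k" using 3 s tk by linarith
          then show "x' + s *\<^sub>R v \<in> ball y ey" using near[of s t ey] e kv t(2) by simp
          have "s * (N j \<bullet> v) > \<tau> x' * (N j \<bullet> v)" using s vj by simp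
          then show "offset j < N j \<bullet> (x' + s *\<^sub>R v)"
            using vj by (simp add: \<tau>_def inner_add_right)
        qed
      qed
    qed
    have sh: "shear i j v x' = x' + \<tau> x' *\<^sub>R v" using shear_on_plane[OF x'(2)] by (simp add: \<tau>_def)
    have "x' + \<tau> x' *\<^sub>R v \<in> ball y ey" using near[of "\<tau> x'" t ey] tk e kv t(2) by simp
    moreover have "N j \<bullet> (x' + \<tau> x' *\<^sub>R v) = offset j" using vj by (simp add: \<tau>_def inner_add_right)
    ultimately have yc: "shear i j v x' \<in> face_core j" using ey(2) sh by (auto simp: face_plane_def)
    have "\<tau> x' > 0" using tk k by linarith
    then have "chord v x' (shear i j v x')"
      using int sh face_core_not_interior[OF i(1) core] face_core_not_interior[OF j(1) yc]
      unfolding chord_def by blast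
    then show ?thesis using core yc by blast
  qed
  then show ?thesis using e(1) by blast
qed


section \<open>Planes through edges parallel to a direction\<close>

definition edge_planes :: "pt \<Rightarrow> (pt \<times> real) set" where
  "edge_planes v = (SOME K. finite K \<and> (\<forall>(w,d)\<in>K. w \<noteq> 0 \<and> w \<bullet> v = 0) \<and>
    (\<forall>x\<in>(\<Union>i\<in>I. F i - face_core i). \<exists>(w,d)\<in>K. w \<bullet> x = d))"

lemma edge_planes: "finite (edge_planes v)" "\<forall>(w,d)\<in>edge_planes v. w \<noteq> 0 \<and> w \<bullet> v = 0"
  "\<And>i x. i \<in> I \<Longrightarrow> x \<in> F i \<Longrightarrow> x \<notin> face_core i \<Longrightarrow> \<exists>(w,d)\<in>edge_planes v. w \<bullet> x = d"
proof -
  have "finite (edge_planes v) \<and> (\<forall>(w,d)\<in>edge_planes v. w \<noteq> 0 \<and> w \<bullet> v = 0) \<and>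
    (\<forall>x\<in>(\<Union>i\<in>I. F i - face_core i). \<exists>(w,d)\<in>edge_planes v. w \<bullet> x = d)"
    unfolding edge_planes_def
    by (rule someI_ex, rule segment_covered_parallel_planes, rule segment_covered_face_edges)
  then show "finite (edge_planes v)" "\<forall>(w,d)\<in>edge_planes v. w \<noteq> 0 \<and> w \<bullet> v = 0"
    "\<And>i x. i \<in> I \<Longrightarrow> x \<in> F i \<Longrightarrow> x \<notin> face_core i \<Longrightarrow> \<exists>(w,d)\<in>edge_planes v. w \<bullet> x = d"
    by blast+
qed

text \<open>The functionals of \<open>edge_planes v\<close> are constant along \<open>v\<close>, so a chord ending on an edge
  starts on one of these planes.\<close>
lemma chord_between_cores_off_edge_planes:
  assumes "i \<in> I" "x \<in> F i" "N i \<bullet> v > 0" "\<forall>(w,d)\<in>edge_planes v. w \<bullet> x \<noteq> d"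
  shows "x \<in> face_core i" "\<exists>j\<in>I. \<exists>y\<in>face_core j. chord v x y"
proof -
  show c: "x \<in> face_core i" using edge_planes(3)[OF assms(1,2), of v] assms(4) by blast
  obtain y where y: "y \<in> frontier V" "chord v x y" using chord_exists assms(1,3) c by blast
  then obtain j where j: "j \<in> I" "y \<in> F j" using frontier_V by blast
  obtain t where t: "y = x + t *\<^sub>R v" using y(2) by (auto simp: chord_def)
  have "w \<bullet> y = w \<bullet> x" if "(w,d) \<in> edge_planes v" for w d
  proof -
    have "w \<bullet> v = 0" using edge_planes(2) that by blast
    then show ?thesis by (simp add: t inner_add_right)
  qed
  then have "\<forall>(w,d)\<in>edge_planes v. w \<bullet> y \<noteq> d" using assms(4) by fastforce
  then have "y \<in> face_core j" using edge_planes(3)[OF j, of v] by blast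
  then show "\<exists>j\<in>I. \<exists>y\<in>face_core j. chord v x y" using j y by blast
qed

text \<open>Two moves are needed: into the relative interior of the face, where a disc of its plane
  is available, and then off the planes inside this disc.\<close>

lemma face_point_near_off_edge_planes:
  assumes i: "i \<in> I" "x \<in> F i" and v: "N i \<bullet> v > 0" and e: "e > 0"
  shows "\<exists>x'\<in>F i. dist x' x < e \<and> (\<forall>(w,d)\<in>edge_planes v. w \<bullet> x' \<noteq> d)"
proof -
  obtain z where z: "z \<in> rel_interior (F i)" "dist z x < e/2"
    using F_subset_closure_rel_interior i e closure_approachable
    by (metis half_gt_zero_iff subsetD)
  obtain r where r: "r > 0" "ball z r \<inter> face_plane i \<subseteq> rel_interior (F i)"
    using rel_interior_F_ball i z by blast
  obtain x' where x': "N i \<bullet> x' = N i \<bullet> z" "dist z x' < min r (e/2)" "\<forall>(w,d)\<in>edge_planes v. w \<bullet> x' \<noteq> d"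
    using hyperplane_point_off_planes[OF edge_planes(1,2), of "N i" v "min r (e/2)" z] v r e by auto
  have "z \<in> face_plane i" using z F_subset_plane i rel_interior_subset by blast
  then have "x' \<in> ball z r \<inter> face_plane i" using x' by (simp add: face_plane_def)
  then have "x' \<in> F i" using r rel_interior_subset by blast
  moreover have "dist x' x < e" using dist_triangle[of x' x z] x'(2) z(2) by (simp add: dist_commute)
  ultimately show ?thesis using x' by blast
qed

lemma shear_plane: "N j \<bullet> v \<noteq> 0 \<Longrightarrow> x \<in> face_plane i \<Longrightarrow> shear i j v x \<in> face_plane j"
  by (simp add: shear_on_plane) (simp add: face_plane_def inner_add_right)

lemma inner_shear: "w \<bullet> v = 0 \<Longrightarrow> w \<bullet> shear i j v x = w \<bullet> x"
  by (simp add: shear_def inner_add_right)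

lemma continuous_on_shear: "continuous_on S (shear i j v)"
  unfolding shear_def divide_inverse by (intro continuous_intros)

lemma smooth_on_shear_fst: "smooth_on UNIV (\<lambda>p::phase. (shear i j v (fst p), u::pt))"
proof -
  let ?L = "\<lambda>p::phase. (fst p + ((N i \<bullet> fst p) / (N i \<bullet> v) - (N j \<bullet> fst p) / (N j \<bullet> v)) *\<^sub>R v, 0::pt)"
  have "linear ?L"
    by (rule linearI) (auto simp: inner_add_right algebra_simps add_divide_distrib)
  then have "bounded_linear ?L" by (simp add: linear_conv_bounded_linear)
  from smooth_on_affine[OF this, of "((offset j / (N j \<bullet> v) - offset i / (N i \<bullet> v)) *\<^sub>R v, u)"]
  show ?thesis by (simp add: shear_def algebra_simps diff_divide_distrib)
qed

end

section \<open>The directional billiard map\<close>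

locale rational_billiard = polytop_billiard V I F N
  for V :: "pt set" and I :: "'i set" and F :: "'i \<Rightarrow> pt set" and N :: "'i \<Rightarrow> pt" +
  fixes \<omega> :: pt
  assumes finite_group: "finite (refl_group I N)"
begin

abbreviation "T \<equiv> billiard_map V I F N"
abbreviation "S \<equiv> cross_section I F N \<omega>"
abbreviation "R \<equiv> discont_partition V I F N \<omega>"
abbreviation "reg \<equiv> regular_set V I F N \<omega>"

definition dirs :: "pt set" where
  "dirs = (\<lambda>g. g \<omega>) ` refl_group I N"

lemma finite_dirs: "finite dirs"
  using finite_group by (simp add: dirs_def)

lemma dirs_reflect: "v \<in> dirs \<Longrightarrow> i \<in> I \<Longrightarrow> reflect (N i) v \<in> dirs"
proof -
  assume v: "v \<in> dirs" and i: "i \<in> I"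
  obtain g where g: "g \<in> refl_group I N" "v = g \<omega>" using v by (auto simp: dirs_def)
  then have "reflect (N i) v = (reflect (N i) \<circ> g) \<omega>" by simp
  then show ?thesis unfolding dirs_def using refl_group_step[OF g(1) i] by blast
qed

lemma norm_reflect: "i \<in> I \<Longrightarrow> norm (reflect (N i) v) = norm v"
  using inner_reflect(1)[OF norm_N, of i v v] by (simp add: norm_eq_sqrt_inner)

text \<open>The faces of departure and arrival are kept as parameters because for fixed
  \<open>i\<close>, \<open>j\<close> and \<open>v\<close> the map is a single affine shear.\<close>

definition transit :: "'i \<Rightarrow> 'i \<Rightarrow> pt \<Rightarrow> pt \<Rightarrow> bool" where
  "transit i j v x \<longleftrightarrow> i \<in> I \<and> j \<in> I \<and> v \<in> dirs \<and> x \<in> face_core i \<and>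
     shear i j v x \<in> face_core j \<and> chord v x (shear i j v x)"

lemma transitI:
  "i \<in> I \<Longrightarrow> j \<in> I \<Longrightarrow> v \<in> dirs \<Longrightarrow> x \<in> face_core i \<Longrightarrow> y \<in> face_core j \<Longrightarrow> chord v x y \<Longrightarrow> transit i j v x"
  using chord_shear[of i j v x y] by (simp add: transit_def)

lemma transitD:
  assumes "transit i j v x"
  shows "i \<in> I" "j \<in> I" "v \<in> dirs" "x \<in> face_core i" "shear i j v x \<in> face_core j"
    "N i \<bullet> v > 0" "N j \<bullet> v < 0" "hit_point V x v = shear i j v x" "x \<in> face_plane i"
  using assms chord_departure[of v x] chord_arrival[of v x] chord_hit_point[of v x]
    face_core_plane[of i x]
  by (auto simp: transit_def face_plane_def)

lemma transit_unique: "transit i j v x \<Longrightarrow> transit i' j' v x \<Longrightarrow> i = i' \<and> j = j'"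
  by (metis transitD(1,2,4,5,8) face_core_index_unique face_core_subset subsetD)

text \<open>\<open>regular_set\<close> speaks of the infimum in \<open>exit_time\<close>; from a
  core point in an inward direction this infimum belongs to an actual chord.\<close>

lemma mem_regular_set: "(x, v) \<in> reg \<longleftrightarrow> (\<exists>i j. transit i j v x)"
proof
  assume a: "(x, v) \<in> reg"
  then obtain i j where i: "i \<in> I" "x \<in> face_core i" "N i \<bullet> v > 0"
    and j: "j \<in> I" "hit_point V x v \<in> face_core j" and v: "v \<in> dirs"
    by (auto simp: regular_set_def face_core_def cross_section_def dirs_def)
  obtain y where "chord v x y" using chord_exists i by blast
  then show "\<exists>i j. transit i j v x" using transitI i j v chord_hit_point by metis
next
  assume "\<exists>i j. transit i j v x"
  then obtain i j where t: "transit i j v x" by blast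
  note d = transitD[OF t]
  have "(x, v) \<in> S" using d face_core_subset by (auto simp: cross_section_def dirs_def)
  then show "(x, v) \<in> reg" using d by (auto simp: regular_set_def face_core_def)
qed

lemma billiard_map_transit:
  assumes "transit i j v x"
  shows "T (x, v) = (shear i j v x, reflect (N j) v)"
proof -
  note d = transitD[OF assms]
  have "(THE k. k \<in> I \<and> shear i j v x \<in> rel_interior (F k)) = j"
  proof (rule the_equality)
    show "j \<in> I \<and> shear i j v x \<in> rel_interior (F j)" using d by (auto simp: face_core_def)
    show "k = j" if "k \<in> I \<and> shear i j v x \<in> rel_interior (F k)" for k
      using that d face_core_index_unique rel_interior_subset by blast
  qed
  then show ?thesis by (simp add: billiard_map_def d)
qed

lemma transit_open:
  assumes "transit i j v x"
  shows "\<exists>e>0. \<forall>x'\<in>ball x e \<inter> face_plane i. transit i j v x'"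
  using chord_open[of i x j "shear i j v x" v] assms unfolding transit_def by blast

text \<open>Directions form a finite set, hence are isolated, and near a core point no other face is
  present. So a regular point close to \<open>(x, v)\<close> has the same direction and departs from
  the same face, where \<open>transit_open\<close> applies.\<close>

lemma transit_locally_constant:
  assumes t: "transit i j v x"
  shows "\<exists>e>0. \<forall>q\<in>reg. dist q (x, v) < e \<longrightarrow> snd q = v \<and> transit i j v (fst q)"
proof -
  obtain e1 where e1: "e1 > 0" "\<forall>x'\<in>ball x e1 \<inter> face_plane i. transit i j v x'"
    using transit_open[OF t] by blast
  obtain e2 where e2: "e2 > 0" "\<forall>u\<in>dirs. u \<noteq> v \<longrightarrow> e2 \<le> dist v u"
    using finite_set_avoid[OF finite_dirs] by blast
  obtain e3 where e3: "e3 > 0" "ball x e3 \<inter> frontier V \<subseteq> face_core i"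
    using face_core_local[OF transitD(1,4)[OF t]] by metis
  have "snd q = v \<and> transit i j v (fst q)" if q: "q \<in> reg" "dist q (x, v) < min e1 (min e2 e3)" for q
  proof -
    obtain x' v' where q': "q = (x',v')" by (cases q)
    obtain i' j' where t': "transit i' j' v' x'" using q q' mem_regular_set by blast
    have "dist x' x < min e1 e3" using q(2) dist_fst_le[of q "(x,v)"] q' by simp
    moreover have "dist v' v < e2" using q(2) dist_snd_le[of q "(x,v)"] q' by simp
    ultimately have "v' = v" "x' \<in> ball x e1" "x' \<in> ball x e3"
      using e2(2) transitD(3)[OF t'] by (force simp: dist_commute)+
    moreover have "x' \<in> face_core i"
      using e3(2) \<open>x' \<in> ball x e3\<close> face_core_frontier transitD(1,4)[OF t'] by blast
    then have "x' \<in> face_plane i" using transitD(1)[OF t] face_core_plane by (simp add: face_plane_def)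
    ultimately show ?thesis using e1(2) q' by simp
  qed
  then show ?thesis using e1 e2 e3 by (intro exI[of _ "min e1 (min e2 e3)"]) auto
qed

text \<open>Locally constant data are constant on connected sets; thus a connected set of regular
  points is moved by a single shear.\<close>

lemma connected_regular_transit:
  assumes C: "connected C" "C \<subseteq> reg" and p: "(x, v) \<in> C" "transit i j v x" and q: "q \<in> C"
  shows "snd q = v \<and> transit i j v (fst q)"
proof -
  let ?f = "\<lambda>q. snd q = v \<and> transit i j v (fst q)"
  have "\<forall>a\<in>C. \<forall>\<^sub>F b in at a within C. ?f a = ?f b"
  proof
    fix a assume a: "a \<in> C"
    obtain x' v' where a': "a = (x',v')" by (cases a)
    obtain i' j' where t': "transit i' j' v' x'" using a a' C mem_regular_set by blast
    obtain e where e: "e > 0" "\<forall>q\<in>reg. dist q a < e \<longrightarrow> snd q = v' \<and> transit i' j' v' (fst q)"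
      using transit_locally_constant[OF t'] a' by blast
    have "?f a = ?f b" if "b \<in> C" "dist b a < e" for b
    proof -
      have b: "snd b = v'" "transit i' j' v' (fst b)" using e(2) that C(2) by auto
      show ?thesis
      proof (cases "v' = v")
        case True
        then have "transit i j v (fst b) \<longleftrightarrow> i = i' \<and> j = j'" "transit i j v x' \<longleftrightarrow> i = i' \<and> j = j'"
          using b(2) t' transit_unique by blast+
        then show ?thesis using b a' True by simp
      qed (use b a' in simp)
    qed
    then show "\<forall>\<^sub>F b in at a within C. ?f a = ?f b"
      unfolding eventually_at using e(1) by blast
  qed
  then have "?f (x, v) = ?f q" using connected_local_const[OF C(1) p(1) q, of ?f] by blast
  then show ?thesis using p(2) by simp
qed


section \<open>Polygonal structure of the atoms\<close>

lemma atom_structure: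
  assumes "A \<in> R"
  obtains i j v P where "A = P \<times> {v}" "P \<noteq> {}" "\<And>x. x \<in> P \<Longrightarrow> transit i j v x"
    "openin (top_of_set (face_plane i)) P"
    "\<And>x. x \<in> closure P - P \<Longrightarrow> \<exists>(w,d)\<in>edge_planes v. w \<bullet> x = d"
proof -
  obtain p where p: "p \<in> reg" "A = connected_component_set reg p"
    using assms by (auto simp: discont_partition_def)
  obtain x0 v where p': "p = (x0, v)" by (cases p)
  obtain i j where t: "transit i j v x0" using p p' mem_regular_set by blast
  have cA: "connected A" "A \<subseteq> reg" "p \<in> A"
    using p by (auto simp: connected_component_subset connected_component_refl)
  have tr: "snd q = v \<and> transit i j v (fst q)" if "q \<in> A" for q
    using connected_regular_transit[OF cA(1,2) _ t that] cA(3) p' by blast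
  define P where "P = fst ` A"
  have A: "A = P \<times> {v}" using tr by (force simp: P_def)
  have trP: "transit i j v x" if "x \<in> P" for x using tr that by (auto simp: P_def)
  \<comment> \<open>Maximality of the component: every connected regular piece with direction
    \<open>v\<close> that touches \<open>A\<close> is absorbed by it.\<close>
  have grow: "B \<times> {v} \<subseteq> A" if "connected B" "B \<times> {v} \<subseteq> reg" "z \<in> B" "(z, v) \<in> A" for B z
  proof -
    have "connected (B \<times> {v})" using that(1) by (simp add: connected_Times)
    then have "B \<times> {v} \<subseteq> connected_component_set reg (z, v)"
      using that by (intro connected_component_maximal) auto
    also have "\<dots> = A" using that(4) p(2) connected_component_eq by metis
    finally show ?thesis .
  qed
  have op: "\<exists>e>0. ball x e \<inter> face_plane i \<subseteq> P" if xP: "x \<in> P" for x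
  proof -
    obtain e where e: "e > 0" "\<forall>x'\<in>ball x e \<inter> face_plane i. transit i j v x'"
      using transit_open[OF trP[OF xP]] by blast
    have "connected (ball x e \<inter> face_plane i)"
      unfolding face_plane_def by (intro convex_connected convex_Int convex_hyperplane) simp
    moreover have "(ball x e \<inter> face_plane i) \<times> {v} \<subseteq> reg" using e(2) mem_regular_set by blast
    moreover have "x \<in> ball x e \<inter> face_plane i" using e(1) transitD(9)[OF trP[OF xP]] by simp
    ultimately have "(ball x e \<inter> face_plane i) \<times> {v} \<subseteq> A" using grow xP A by blast
    then show ?thesis using e(1) A by blast
  qed
  have PF: "P \<subseteq> F i" using trP transitD(4) face_core_subset by blast
  have iI: "i \<in> I" and vi: "N i \<bullet> v > 0" and vd: "v \<in> dirs" using transitD[OF t] by auto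
  have oP: "openin (top_of_set (face_plane i)) P"
    unfolding openin_contains_ball using op PF F_subset_plane[OF iI] by blast
  \<comment> \<open>A boundary point on no edge plane would be regular together with a disc around
    it; the disc meets \<open>P\<close>, so the point would belong to the same component.\<close>
  have fr: "\<exists>(w,d)\<in>edge_planes v. w \<bullet> x = d" if x: "x \<in> closure P - P" for x
  proof (rule ccontr)
    assume n: "\<not> (\<exists>(w,d)\<in>edge_planes v. w \<bullet> x = d)"
    have xF: "x \<in> F i" using x PF closed_F[OF iI] closure_minimal by blast
    have off: "\<forall>(w,d)\<in>edge_planes v. w \<bullet> x \<noteq> d" using n by blast
    obtain k y where "x \<in> face_core i" "k \<in> I" "y \<in> face_core k" "chord v x y"
      using chord_between_cores_off_edge_planes[OF iI xF vi off] by blast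
    then have "transit i k v x" using transitI iI vd by blast
    then obtain e where e: "e > 0" "\<forall>x'\<in>ball x e \<inter> face_plane i. transit i k v x'"
      using transit_open by blast
    obtain z where z: "z \<in> P" "dist z x < e" using x e(1) closure_approachable by blast
    have xpl: "x \<in> face_plane i" "z \<in> face_plane i" using xF z PF F_subset_plane[OF iI] by auto
    have "connected (ball x e \<inter> face_plane i)"
      unfolding face_plane_def by (intro convex_connected convex_Int convex_hyperplane) simp
    moreover have "(ball x e \<inter> face_plane i) \<times> {v} \<subseteq> reg" using e(2) mem_regular_set by blast
    moreover have "z \<in> ball x e \<inter> face_plane i" using z xpl by (simp add: dist_commute)
    ultimately have "(ball x e \<inter> face_plane i) \<times> {v} \<subseteq> A" using grow z(1) A by blast
    then have "(x, v) \<in> A" using e(1) xpl by auto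
    then show False using x A by blast
  qed
  show thesis using that[OF A _ trP oP fr] cA(3) by (auto simp: P_def)
qed

lemma Union_R: "\<Union>R = reg"
proof
  show "\<Union>R \<subseteq> reg" unfolding discont_partition_def using connected_component_subset by blast
  show "reg \<subseteq> \<Union>R"
  proof
    fix p assume p: "p \<in> reg"
    then have "p \<in> connected_component_set reg p" by (simp add: connected_component_refl)
    then show "p \<in> \<Union>R" using p unfolding discont_partition_def by blast
  qed
qed

lemma regular_subset_S: "reg \<subseteq> S"
  by (auto simp: regular_set_def)

lemma S_subset_closure_regular: "S \<subseteq> closure reg"
proof
  fix p assume "p \<in> S"
  then obtain x v i where p: "p = (x, v)" "v \<in> dirs" "i \<in> I" "x \<in> F i" "N i \<bullet> v > 0"
    by (auto simp: cross_section_def dirs_def)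
  show "p \<in> closure reg" unfolding closure_approachable
  proof (intro allI impI)
    fix e :: real assume "e > 0"
    then obtain x' where x': "x' \<in> F i" "dist x' x < e" "\<forall>(w,d)\<in>edge_planes v. w \<bullet> x' \<noteq> d"
      using face_point_near_off_edge_planes p by blast
    obtain k y where "x' \<in> face_core i" "k \<in> I" "y \<in> face_core k" "chord v x' y"
      using chord_between_cores_off_edge_planes[OF p(3) x'(1) p(5) x'(3)] by blast
    then have "transit i k v x'" using transitI p by blast
    then have "(x', v) \<in> reg" using mem_regular_set by blast
    moreover have "dist (x', v) p < e" using x' p by (simp add: dist_Pair_Pair)
    ultimately show "\<exists>y\<in>reg. dist y p < e" by blast
  qed
qed

text \<open>Sign cells of the plane arrangement are convex, so the segment stays off all planes.
  Then it cannot leave the face, whose relative frontier lies on these planes, and all its points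
  are regular. Equality of the arrival faces is a consequence.\<close>

lemma same_cell_same_component:
  assumes t: "transit i j v x" "transit i j' v y"
    and off: "\<forall>(w,d)\<in>edge_planes v. w \<bullet> x \<noteq> d" "\<forall>(w,d)\<in>edge_planes v. w \<bullet> y \<noteq> d"
    and same: "\<And>w d. (w,d) \<in> edge_planes v \<Longrightarrow> w \<bullet> x > d \<longleftrightarrow> w \<bullet> y > d"
  shows "connected_component reg (x, v) (y, v)"
proof -
  let ?C = "closed_segment x y"
  note d = transitD[OF t(1)]
  have offC: "w \<bullet> z \<noteq> c" if wc: "(w,c) \<in> edge_planes v" and z: "z \<in> ?C" for w c z
  proof -
    have "w \<bullet> x \<noteq> c" "w \<bullet> y \<noteq> c" using off wc by auto
    then consider "w \<bullet> x > c" "w \<bullet> y > c" | "w \<bullet> x < c" "w \<bullet> y < c"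
      using same[OF wc] by force
    then show ?thesis
    proof cases
      case 1
      then have "?C \<subseteq> {z. w \<bullet> z > c}"
        by (intro closed_segment_subset convex_halfspace_gt) auto
      then show ?thesis using z by auto
    next
      case 2
      then have "?C \<subseteq> {z. w \<bullet> z < c}"
        by (intro closed_segment_subset convex_halfspace_lt) auto
      then show ?thesis using z by auto
    qed
  qed
  have pl: "?C \<subseteq> face_plane i"
    using transitD(9)[OF t(1)] transitD(9)[OF t(2)] unfolding face_plane_def
    by (intro closed_segment_subset convex_hyperplane) auto
  have "?C \<inter> rel_frontier (F i) = {}"
  proof (rule ccontr)
    assume "?C \<inter> rel_frontier (F i) \<noteq> {}"
    then obtain z where z: "z \<in> ?C" "z \<in> F i" "z \<notin> rel_interior (F i)"
      using closed_F[OF d(1)] by (auto simp: rel_frontier_def)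
    then have "z \<notin> face_core i" by (auto simp: face_core_def)
    then show False using edge_planes(3)[OF d(1) z(2), of v] offC z(1) by blast
  qed
  moreover have "x \<in> rel_interior (F i)" using d(4) by (auto simp: face_core_def)
  ultimately have "?C \<subseteq> rel_interior (F i)"
    using connected_subset_rel_open[of ?C "F i" x] pl affine_hull_F[OF d(1)] by simp
  then have CF: "?C \<subseteq> F i" using rel_interior_subset by blast
  have "(z, v) \<in> reg" if z: "z \<in> ?C" for z
  proof -
    have "z \<in> F i" "\<forall>(w,d)\<in>edge_planes v. w \<bullet> z \<noteq> d" using CF z offC by auto
    then obtain k y where "z \<in> face_core i" "k \<in> I" "y \<in> face_core k" "chord v z y"
      using chord_between_cores_off_edge_planes[OF d(1) _ d(6)] by blast
    then show ?thesis using transitI[OF d(1) _ d(3)] mem_regular_set by blast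
  qed
  moreover have "connected (?C \<times> {v})" by (simp add: connected_Times)
  ultimately show ?thesis unfolding connected_component_def
    by (intro exI[of _ "?C \<times> {v}"]) auto
qed

lemma finite_R: "finite R"
proof -
  define off where "off = (\<lambda>v x. \<forall>(w,d)\<in>edge_planes v. w \<bullet> (x::pt) \<noteq> d)"
  \<comment> \<open>The sign pattern of a generic point relative to the edge planes, together with
    face and direction, determines its component. There are finitely many such data, and every atom,
    being relatively open, contains a generic point.\<close>
  define code where "code = (\<lambda>i v x \<sigma>. (\<exists>j. transit i j v x) \<and> off v x \<and> \<sigma> = {(w,d)\<in>edge_planes v. w \<bullet> x > d})"
  define h where "h = (\<lambda>(i, v, \<sigma>). connected_component_set reg (SOME x. code i v x \<sigma>, v))"
  let ?X = "I \<times> dirs \<times> Pow (\<Union>v\<in>dirs. edge_planes v)"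
  have "finite ?X" using finite_I finite_dirs edge_planes(1) by simp
  moreover have "R \<subseteq> h ` ?X"
  proof
    fix A assume A: "A \<in> R"
    obtain i j v P where P: "A = P \<times> {v}" "P \<noteq> {}" "\<And>x. x \<in> P \<Longrightarrow> transit i j v x"
      "openin (top_of_set (face_plane i)) P" using atom_structure[OF A] by metis
    obtain x0 where x0: "x0 \<in> P" using P by blast
    note d = transitD[OF P(3)[OF x0]]
    obtain e where e: "e > 0" "ball x0 e \<inter> face_plane i \<subseteq> P"
      using P(4) x0 openin_contains_ball by metis
    obtain x where x: "N i \<bullet> x = N i \<bullet> x0" "dist x0 x < e" "off v x"
      using hyperplane_point_off_planes[OF edge_planes(1,2), of "N i" v e x0] d e unfolding off_def by auto
    have xP: "x \<in> P" using e(2) x d(9) by (auto simp: face_plane_def)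
    define \<sigma> where "\<sigma> = {(w,d)\<in>edge_planes v. w \<bullet> x > d}"
    have "code i v x \<sigma>" using P(3)[OF xP] x by (auto simp: code_def \<sigma>_def)
    then have c: "code i v (SOME x. code i v x \<sigma>) \<sigma>" by (rule someI)
    let ?y = "SOME x. code i v x \<sigma>"
    obtain j' where j': "transit i j' v ?y" using c by (auto simp: code_def)
    have "connected_component reg (?y, v) (x, v)"
    proof (rule same_cell_same_component[OF j' P(3)[OF xP]])
      show "\<forall>(w,d)\<in>edge_planes v. w \<bullet> ?y \<noteq> d" using c by (simp add: code_def off_def)
      show "\<forall>(w,d)\<in>edge_planes v. w \<bullet> x \<noteq> d" using x by (simp add: off_def)
      have "\<sigma> = {(w,d)\<in>edge_planes v. w \<bullet> ?y > d}" using c by (simp add: code_def)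
      then show "w \<bullet> ?y > d \<longleftrightarrow> w \<bullet> x > d" if "(w,d) \<in> edge_planes v" for w d
        using that \<sigma>_def by blast
    qed
    then have "connected_component_set reg (?y, v) = connected_component_set reg (x, v)"
      by (simp add: connected_component_eq_eq connected_component_in)
    moreover have "connected_component_set reg (x, v) = A"
    proof -
      obtain p where p: "A = connected_component_set reg p" using A by (auto simp: discont_partition_def)
      have "(x, v) \<in> A" using xP P by blast
      then show ?thesis using p connected_component_eq by metis
    qed
    ultimately have "A = h (i, v, \<sigma>)" by (simp add: h_def)
    moreover have "(i, v, \<sigma>) \<in> ?X" using d by (auto simp: \<sigma>_def)
    ultimately show "A \<in> h ` ?X" by blast
  qed
  ultimately show ?thesis using finite_subset by blast
qed

lemma disjoint_R: "pairwise disjnt R"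
proof (rule pairwiseI)
  fix A B assume "A \<in> R" "B \<in> R" "A \<noteq> B"
  then show "disjnt A B" unfolding discont_partition_def disjnt_def
    by (auto simp: connected_component_disjoint) (metis connected_component_eq mem_Collect_eq)+
qed

lemma bounded_face_core: "i \<in> I \<Longrightarrow> bounded (face_core i)"
  using compact_F compact_imp_bounded bounded_subset face_core_subset by blast

lemma polygon_partition_R: "polygon_partition S R"
  unfolding polygon_partition_def
proof (intro conjI ballI)
  fix A assume A: "A \<in> R"
  obtain i j v P where P: "A = P \<times> {v}" "P \<noteq> {}" "\<And>x. x \<in> P \<Longrightarrow> transit i j v x"
    "openin (top_of_set (face_plane i)) P"
    "\<And>x. x \<in> closure P - P \<Longrightarrow> \<exists>(w,d)\<in>edge_planes v. w \<bullet> x = d"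
    using atom_structure[OF A] by metis
  obtain x0 where x0: "x0 \<in> P" using P by blast
  note d = transitD[OF P(3)[OF x0]]
  have "P \<subseteq> face_core i" using P(3) transitD(4) by blast
  then have "bounded P" using bounded_face_core[OF d(1)] bounded_subset by blast
  then show "open_polygon A" unfolding P(1)
    using open_polygon_transversal[OF P(2) _ P(4)[unfolded face_plane_def] _ edge_planes(1,2) P(5)] d by simp
  show "A \<subseteq> S" using A Union_R regular_subset_S by blast
next
  show "finite R" by (rule finite_R)
  show "pairwise disjnt R" by (rule disjoint_R)
  show "S \<subseteq> closure (\<Union>R)" using S_subset_closure_regular Union_R by simp
qed

section \<open>Injectivity and images of the atoms\<close>

lemma inj_on_T: "inj_on T reg"
proof (rule inj_onI)
  fix p q assume pq: "p \<in> reg" "q \<in> reg" "T p = T q"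
  obtain x v where p: "p = (x, v)" by (cases p)
  obtain x' v' where q: "q = (x', v')" by (cases q)
  obtain i j where t: "transit i j v x" using pq p mem_regular_set by blast
  obtain i' j' where t': "transit i' j' v' x'" using pq q mem_regular_set by blast
  have e: "shear i j v x = shear i' j' v' x'" "reflect (N j) v = reflect (N j') v'"
    using pq(3) billiard_map_transit[OF t] billiard_map_transit[OF t'] p q by auto
  have jj: "j = j'"
    using face_core_index_unique face_core_subset e(1) transitD(2,5)[OF t] transitD(2,5)[OF t'] by (metis subsetD)
  then have vv: "v = v'" using e(2) inner_reflect(2) norm_N transitD(2)[OF t] by metis
  \<comment> \<open>Time reversal: both starting points are the exit point of one and the same
    backward ray.\<close>
  have "chord (- v) (shear i j v x) x" "chord (- v) (shear i j v x) x'"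
    using t t' e(1) jj vv chord_reverse unfolding transit_def by metis+
  then have "x = x'" using chord_hit_point by metis
  then show "p = q" using p q vv by simp
qed

lemma T_image_S: "p \<in> reg \<Longrightarrow> T p \<in> S"
proof -
  assume r: "p \<in> reg"
  obtain x v where p: "p = (x, v)" by (cases p)
  obtain i j where t: "transit i j v x" using r p mem_regular_set by blast
  note d = transitD[OF t]
  have "reflect (N j) v \<in> dirs" "N j \<bullet> reflect (N j) v > 0"
    using dirs_reflect d inner_reflect(3)[OF norm_N[OF d(2)]] by auto
  then show ?thesis using d face_core_subset
    by (auto simp: p billiard_map_transit[OF t] cross_section_def dirs_def)
qed

text \<open>Reverse time and shoot from a generic point in the direction \<open>- v\<close>.\<close>
lemma S_subset_closure_image: "S \<subseteq> closure (T ` reg)"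
proof
  fix p assume "p \<in> S"
  then obtain y u j where p: "p = (y, u)" "u \<in> dirs" "j \<in> I" "y \<in> F j" "N j \<bullet> u > 0"
    by (auto simp: cross_section_def dirs_def)
  define v where "v = reflect (N j) u"
  have v: "v \<in> dirs" "N j \<bullet> (- v) > 0" "reflect (N j) v = u"
    using p dirs_reflect inner_reflect(2,3)[OF norm_N[OF p(3)]] by (auto simp: v_def)
  show "p \<in> closure (T ` reg)" unfolding closure_approachable
  proof (intro allI impI)
    fix e :: real assume "e > 0"
    then obtain y' where y': "y' \<in> F j" "dist y' y < e" "\<forall>(w,d)\<in>edge_planes (- v). w \<bullet> y' \<noteq> d"
      using face_point_near_off_edge_planes p v by blast
    obtain i x where x: "y' \<in> face_core j" "i \<in> I" "x \<in> face_core i" "chord (- v) y' x"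
      using chord_between_cores_off_edge_planes[OF p(3) y'(1) v(2) y'(3)] by blast
    have c: "chord v x y'" using chord_reverse[OF x(4)] by simp
    then have t: "transit i j v x" using transitI x p v by blast
    then have "T (x, v) = (y', u)"
      using billiard_map_transit chord_shear[OF x(2) p(3) c x(3) x(1)] v by simp
    moreover have "(x, v) \<in> reg" using t mem_regular_set by blast
    moreover have "dist (y', u) p < e" using y' p by (simp add: dist_Pair_Pair)
    ultimately show "\<exists>q\<in>T ` reg. dist q p < e" by (metis image_eqI)
  qed
qed

lemma T_image_atom:
  assumes "A = P \<times> {v}" "\<And>x. x \<in> P \<Longrightarrow> transit i j v x"
  shows "T ` A = shear i j v ` P \<times> {reflect (N j) v}"
  unfolding assms(1) using billiard_map_transit[OF assms(2)] by force

text \<open>The image is the preimage of \<open>P\<close> under the opposite shear. Its boundary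
  points therefore come from boundary points of \<open>P\<close>, and functionals orthogonal to
  \<open>v\<close> take the same values at both, so the same planes bound it.\<close>

lemma open_polygon_T_image:
  assumes A: "A \<in> R"
  shows "open_polygon (T ` A)"
proof -
  obtain i j v P where P: "A = P \<times> {v}" "P \<noteq> {}" "\<And>x. x \<in> P \<Longrightarrow> transit i j v x"
    "openin (top_of_set (face_plane i)) P"
    "\<And>x. x \<in> closure P - P \<Longrightarrow> \<exists>(w,d)\<in>edge_planes v. w \<bullet> x = d"
    using atom_structure[OF A] by metis
  obtain x0 where x0: "x0 \<in> P" using P by blast
  note d = transitD[OF P(3)[OF x0]]
  let ?Q = "shear i j v ` P"
  have inv: "shear j i v (shear i j v x) = x" "shear i j v (shear j i v x) = x" for x
    using shear_inverse d by auto
  have "?Q \<subseteq> face_core j" using P(3) transitD(5) by blast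
  then have b: "bounded ?Q" using bounded_face_core[OF d(2)] bounded_subset by blast
  have Pp: "P \<subseteq> face_plane i" using P(4) openin_imp_subset by blast
  have Q: "?Q = face_plane j \<inter> shear j i v -` P"
  proof (intro equalityI subsetI)
    fix y assume "y \<in> ?Q"
    then show "y \<in> face_plane j \<inter> shear j i v -` P" using inv Pp shear_plane[of j v] d by auto
  next
    fix y assume "y \<in> face_plane j \<inter> shear j i v -` P"
    then show "y \<in> ?Q" using inv(2)[of y] by (metis IntD2 image_eqI vimageD)
  qed
  have op: "openin (top_of_set (face_plane j)) ?Q" unfolding Q
    by (rule continuous_openin_preimage[OF continuous_on_shear _ P(4)])
      (use shear_plane[of i v _ j] d in auto)
  have fr: "\<exists>(w,d)\<in>edge_planes v. w \<bullet> y = d" if y: "y \<in> closure ?Q - ?Q" for y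
  proof -
    have "shear j i v ` closure ?Q \<subseteq> closure (shear j i v ` ?Q)"
      by (rule image_closure_subset) (auto simp: continuous_on_shear closure_subset)
    also have "shear j i v ` ?Q = P" using inv by (simp add: image_image)
    finally have "shear j i v y \<in> closure P" using y by blast
    moreover have "shear j i v y \<notin> P" using y inv(2)[of y] by (metis DiffD2 image_eqI)
    ultimately obtain w c where w: "(w,c) \<in> edge_planes v" "w \<bullet> shear j i v y = c"
      using P(5) by blast
    then have "w \<bullet> v = 0" using edge_planes(2) by blast
    then show ?thesis using w inner_shear by auto
  qed
  have "open_polygon (?Q \<times> {reflect (N j) v})"
    by (rule open_polygon_transversal[OF _ b op[unfolded face_plane_def] _ edge_planes(1,2) fr]) (use P d in auto)
  then show ?thesis using T_image_atom[OF P(1,3)] by simp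
qed

lemma homeomorphism_T_atom:
  assumes A: "A \<in> R"
  shows "\<exists>g. homeomorphism A (T ` A) T g" "\<exists>W \<Phi>. A \<subseteq> W \<and> smooth_on W \<Phi> \<and> (\<forall>p\<in>A. \<Phi> p = T p)"
proof -
  obtain i j v P where P: "A = P \<times> {v}" "P \<noteq> {}" "\<And>x. x \<in> P \<Longrightarrow> transit i j v x"
    using atom_structure[OF A] by metis
  obtain x0 where x0: "x0 \<in> P" using P by blast
  note d = transitD[OF P(3)[OF x0]]
  have eq: "(shear i j v (fst p), reflect (N j) v) = T p" if "p \<in> A" for p
    using that billiard_map_transit[OF P(3)] P(1) by auto
  then show "\<exists>W \<Phi>. A \<subseteq> W \<and> smooth_on W \<Phi> \<and> (\<forall>p\<in>A. \<Phi> p = T p)"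
    using smooth_on_shear_fst by blast
  have cont: "continuous_on C (\<lambda>p. (shear k l v (fst p), u))" for C k l and u :: pt
    by (intro continuous_intros continuous_on_compose2[OF continuous_on_shear[of UNIV]]) auto
  have "homeomorphism A (T ` A) T (\<lambda>p. (shear j i v (fst p), v))"
  proof (rule homeomorphismI)
    show "continuous_on A T" using cont by (rule continuous_on_eq) (rule eq)
    show "continuous_on (T ` A) (\<lambda>p. (shear j i v (fst p), v))" by (rule cont)
    have inv: "(shear j i v (fst (T p)), v) = p" if "p \<in> A" for p
      using eq[OF that, symmetric] shear_inverse[of i v j "fst p"] d that P(1) by auto
    show "(\<lambda>p. (shear j i v (fst p), v)) ` T ` A \<subseteq> A"
      unfolding image_image using inv by (intro image_subsetI) simp
    show "(shear j i v (fst (T p)), v) = p" if "p \<in> A" for p by (rule inv[OF that])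
    show "T (shear j i v (fst q), v) = q" if q: "q \<in> T ` A" for q
    proof -
      obtain p where "p \<in> A" "q = T p" using q by blast
      then show ?thesis using inv by simp
    qed
  qed auto
  then show "\<exists>g. homeomorphism A (T ` A) T g" by blast
qed

lemma atom_subset_regular: "A \<in> R \<Longrightarrow> A \<subseteq> reg"
  using Union_R by blast

lemma T_images_disjoint:
  assumes "A \<in> R" "B \<in> R" "A \<noteq> B"
  shows "T ` A \<inter> T ` B = {}"
proof -
  have "A \<inter> B = {}" using disjoint_R assms by (meson disjnt_def pairwiseD)
  then show ?thesis
    using inj_on_image_Int[OF inj_on_T] atom_subset_regular assms(1,2) by (metis image_empty)
qed

theorem gen_polygon_exchange_T: "gen_polygon_exchange S R T"
  unfolding gen_polygon_exchange_def
proof (intro conjI ballI impI)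
  show "polygon_partition S ((`) T ` R)"
    unfolding polygon_partition_def
  proof (intro conjI ballI)
    show "finite ((`) T ` R)" using finite_R by simp
    show "pairwise disjnt ((`) T ` R)"
      unfolding pairwise_def disjnt_def using T_images_disjoint by blast
    have "\<Union>((`) T ` R) = T ` reg" using Union_R by blast
    then show "S \<subseteq> closure (\<Union>((`) T ` R))" using S_subset_closure_image by simp
  next
    fix B assume "B \<in> (`) T ` R"
    then obtain A where A: "A \<in> R" "B = T ` A" by blast
    show "open_polygon B" using open_polygon_T_image A by blast
    show "B \<subseteq> S" using A atom_subset_regular T_image_S by blast
  qed
qed (use polygon_partition_R homeomorphism_T_atom T_images_disjoint in blast)+

end

section \<open>Counting itineraries\<close>

text \<open>Normals and levels are kept as two separate finite sets: forgetting which level belongs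
  to which normal only adds possible cuts, and makes invariance under reflections a condition on
  \<open>W\<close> alone.\<close>

locale cut_system = rational_billiard V I F N \<omega>
  for V :: "pt set" and I :: "'i set" and F :: "'i \<Rightarrow> pt set" and N :: "'i \<Rightarrow> pt" and \<omega> :: pt +
  fixes U :: "phase set set" and W :: "pt set" and Z :: "real set"
  assumes partition_U: "polygon_partition S U" and refines_U: "refines U R"
    and finite_W: "finite W" and finite_Z: "finite Z" and W_nz: "0 \<notin> W"
    and W_reflect: "w \<in> W \<Longrightarrow> i \<in> I \<Longrightarrow> reflect (N i) w \<in> W"
    and frontier_cut: "P \<times> {v} \<in> U \<Longrightarrow> x \<in> rel_frontier P \<Longrightarrow> \<exists>w\<in>W. w \<bullet> v = 0 \<and> w \<bullet> x \<in> Z"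
begin

lemma U_structure:
  assumes "A \<in> U"
  obtains i j v P where "A = P \<times> {v}" "P \<noteq> {}" "\<And>x. x \<in> P \<Longrightarrow> transit i j v x"
    "affine hull P = face_plane i" "rel_interior P = P"
proof -
  have "open_polygon A" using partition_U assms by (simp add: polygon_partition_def)
  then obtain P v where P: "A = P \<times> {v}" "P \<noteq> {}" "aff_dim P = 2" "rel_interior P = P"
    by (auto simp: open_polygon_def)
  obtain B where B: "B \<in> R" "A \<subseteq> B" using refines_U assms by (auto simp: refines_def)
  obtain i j v' Q where Q: "B = Q \<times> {v'}" "\<And>x. x \<in> Q \<Longrightarrow> transit i j v' x"
    using atom_structure[OF B(1)] by metis
  have sub: "P \<subseteq> Q" "v' = v" using P B Q by auto
  then have tr: "transit i j v x" if "x \<in> P" for x using Q(2) that by blast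
  obtain x0 where "x0 \<in> P" using P by blast
  then have i: "i \<in> I" using tr transitD(1) by blast
  have "P \<subseteq> face_plane i" using tr transitD(9) by blast
  then have "affine hull P = face_plane i"
    using affine_hull_eq_hyperplane[of P "N i" "offset i"] P N_nz[OF i] by (simp add: face_plane_def)
  then show thesis using that P tr by blast
qed

text \<open>In coordinates transverse to the direction of motion the billiard map is a piecewise
  translation, up to relabelling the functionals by a reflection.\<close>
lemma inner_T:
  assumes t: "transit i j v x" and w: "w \<bullet> reflect (N j) v = 0"
  shows "reflect (N j) w \<bullet> v = 0"
    "w \<bullet> fst (T (x, v)) = reflect (N j) w \<bullet> x - 2 * offset j * (reflect (N j) w \<bullet> N j)"
proof -
  note d = transitD[OF t]
  note r = inner_reflect[OF norm_N[OF d(2)]]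
  let ?w = "reflect (N j) w"
  show o: "?w \<bullet> v = 0" using r(1)[of ?w v] r(2) w by simp
  let ?y = "shear i j v x"
  \<comment> \<open>A point of the face is fixed by the mirror in the face plane, whereas the linear
    reflection moves it along the normal; the difference is the translation constant.\<close>
  have "reflect (N j) ?y = ?y - (2 * offset j) *\<^sub>R N j"
    using face_core_plane[OF d(2,5)] by (simp add: reflect_def)
  moreover have "w \<bullet> ?y = ?w \<bullet> reflect (N j) ?y" using r(1) by simp
  ultimately have "w \<bullet> ?y = ?w \<bullet> ?y - 2 * offset j * (?w \<bullet> N j)" by (simp add: inner_diff_right)
  then show "w \<bullet> fst (T (x, v)) = ?w \<bullet> x - 2 * offset j * (?w \<bullet> N j)"
    using inner_shear[OF o] billiard_map_transit[OF t] by simp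
qed

text \<open>These are the coordinate values at time 0 from which a level of \<open>Z\<close> could
  be met during the first \<open>n\<close> steps. The shifts run over all faces and normals instead
  of those along actual orbits; the excess makes the set independent of the point and keeps it
  finite. For \<open>n = 0\<close> nothing is cut.\<close>

fun levels :: "nat \<Rightarrow> real set" where
  "levels 0 = {}"
| "levels (Suc n) = Z \<union> (\<Union>j\<in>I. \<Union>w\<in>W. (\<lambda>z. z + 2 * offset j * (w \<bullet> N j)) ` levels n)"

lemma finite_levels: "finite (levels n)"
  by (induction n) (auto simp: finite_Z finite_I finite_W)

lemma levels_Suc: "levels n \<subseteq> levels (Suc n)"
proof (induction n)
  case (Suc n)
  then have "(\<lambda>z. z + c) ` levels n \<subseteq> (\<lambda>z. z + c) ` levels (Suc n)" for c by (rule image_mono)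
  then show ?case by (subst (1 2) levels.simps) (intro Un_mono UN_mono order_refl, blast)
qed simp

lemma levels_mono: "n \<le> m \<Longrightarrow> levels n \<subseteq> levels m"
  using lift_Suc_mono_le[of levels] levels_Suc by blast

definition atom :: "phase \<Rightarrow> phase set" where
  "atom p = (THE A. A \<in> U \<and> p \<in> A)"

text \<open>The atoms omit their boundaries, so a code carries information only while the orbit
  stays in atoms; elsewhere \<open>atom\<close> is a description without a referent.\<close>

fun itinerary :: "nat \<Rightarrow> phase \<Rightarrow> bool" where
  "itinerary 0 p = True"
| "itinerary (Suc n) p = (p \<in> \<Union>U \<and> itinerary n (T p))"

fun code :: "nat \<Rightarrow> phase \<Rightarrow> phase set list" where
  "code 0 p = []"
| "code (Suc n) p = atom p # code n (T p)"

lemma atom_eq: "A \<in> U \<Longrightarrow> p \<in> A \<Longrightarrow> atom p = A"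
  unfolding atom_def
proof (rule the_equality)
  fix B assume "A \<in> U" "p \<in> A" "B \<in> U \<and> p \<in> B"
  then show "B = A" using partition_U unfolding polygon_partition_def
    by (metis disjnt_iff pairwiseD)
qed simp

lemma code_add: "code (m + n) p = code m p @ code n ((T ^^ m) p)"
  by (induction m arbitrary: p) (auto simp: funpow_swap1)

lemma itinerary_add: "itinerary (m + n) p \<longleftrightarrow> itinerary m p \<and> itinerary n ((T ^^ m) p)"
  by (induction m arbitrary: p) (auto simp: funpow_swap1)

definition generic :: "nat \<Rightarrow> phase \<Rightarrow> bool" where
  "generic n p \<longleftrightarrow> itinerary n p \<and> (\<forall>w\<in>W. w \<bullet> snd p = 0 \<longrightarrow> w \<bullet> fst p \<notin> levels n)"

text \<open>A level met by \<open>T p\<close> would pull back, through the reflected normal and its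
  shift, to a level of the next stage met by \<open>p\<close>.\<close>

lemma generic_T:
  assumes "generic (Suc n) p"
  shows "generic n (T p)"
proof -
  obtain A where A: "A \<in> U" "p \<in> A" using assms by (auto simp: generic_def)
  obtain i j v P where P: "A = P \<times> {v}" "\<And>x. x \<in> P \<Longrightarrow> transit i j v x"
    using U_structure[OF A(1)] by metis
  obtain x where x: "p = (x, v)" "x \<in> P" using A P by auto
  note t = P(2)[OF x(2)]
  have "w \<bullet> fst (T p) \<notin> levels n" if w: "w \<in> W" "w \<bullet> snd (T p) = 0" for w
  proof
    assume l: "w \<bullet> fst (T p) \<in> levels n"
    have w0: "w \<bullet> reflect (N j) v = 0" using w(2) x billiard_map_transit[OF t] by simp
    let ?w = "reflect (N j) w"
    note i = inner_T[OF t w0]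
    have W: "?w \<in> W" "j \<in> I" using W_reflect w(1) transitD(2)[OF t] by auto
    have "?w \<bullet> x = w \<bullet> fst (T p) + 2 * offset j * (?w \<bullet> N j)" using i(2) x(1) by simp
    then have "?w \<bullet> x \<in> levels (Suc n)" using l W by auto
    then show False using assms W(1) i(1) x(1) by (auto simp: generic_def)
  qed
  then show ?thesis using assms by (simp add: generic_def)
qed

lemma generic_mono:
  assumes "generic n p" "m \<le> n"
  shows "generic m p"
proof -
  have "itinerary m p" using assms itinerary_add[of m "n - m" p] by (simp add: generic_def)
  then show ?thesis using assms levels_mono[OF assms(2)] by (auto simp: generic_def)
qed

lemma generic_funpow: "generic (m + n) p \<Longrightarrow> generic n ((T ^^ m) p)"
  by (induction m arbitrary: p) (simp_all add: funpow_swap1 generic_T)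

section \<open>Separation by levels and propagation of small sets\<close>

definition sheet :: "'i \<Rightarrow> pt \<Rightarrow> phase set" where
  "sheet i v = face_core i \<times> {v}"

text \<open>Closed intervals are used because the point where a segment leaves an atom may be its
  endpoint.\<close>

definition unseparated :: "nat \<Rightarrow> phase \<Rightarrow> phase \<Rightarrow> bool" where
  "unseparated n p q \<longleftrightarrow> (\<forall>w\<in>W. w \<bullet> snd p = 0 \<longrightarrow>
     (\<forall>z\<in>levels n. \<not> (w \<bullet> fst p \<le> z \<and> z \<le> w \<bullet> fst q) \<and> \<not> (w \<bullet> fst q \<le> z \<and> z \<le> w \<bullet> fst p)))"

text \<open>Otherwise the segment from \<open>p\<close> to \<open>q\<close>, which stays in the face
  plane, would meet the relative frontier of the atom. There some coordinate takes a value of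
  \<open>Z\<close> between its values at \<open>p\<close> and \<open>q\<close>.\<close>

lemma unseparated_same_atom:
  assumes A: "A \<in> U" "p \<in> A" and i: "i \<in> I" "p \<in> sheet i v" "q \<in> sheet i v"
    and u: "unseparated (Suc n) p q"
  shows "q \<in> A"
proof (rule ccontr)
  assume nq: "q \<notin> A"
  obtain i' j v' P where P: "A = P \<times> {v'}" "\<And>x. x \<in> P \<Longrightarrow> transit i' j v' x"
    "affine hull P = face_plane i'" "rel_interior P = P" using U_structure[OF A(1)] by metis
  obtain x where x: "p = (x, v)" "x \<in> P" "x \<in> face_core i" "v' = v" using A P(1) i by (auto simp: sheet_def)
  obtain y where y: "q = (y, v)" "y \<in> face_core i" using i by (auto simp: sheet_def)
  have "i' = i" using face_core_index_unique face_core_subset transitD(1,4)[OF P(2)[OF x(2)]] x(3) i(1)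
    by (metis subsetD)
  then have pl: "x \<in> face_plane i'" "y \<in> face_plane i'"
    using face_core_plane[OF i(1)] x y by (auto simp: face_plane_def)
  let ?C = "closed_segment x y"
  have "\<not> ?C \<subseteq> rel_interior P" using nq P(1,4) x(4) y(1) by auto
  moreover have "?C \<subseteq> affine hull P" unfolding P(3) using pl unfolding face_plane_def
    by (intro closed_segment_subset convex_hyperplane) auto
  ultimately obtain z where z: "z \<in> ?C" "z \<in> rel_frontier P"
    using connected_subset_rel_open[of ?C P x] P(4) x(2) by auto
  obtain w where w: "w \<in> W" "w \<bullet> v = 0" "w \<bullet> z \<in> Z" using frontier_cut z(2) A(1) P(1) x(4) by metis
  obtain s where s: "0 \<le> s" "s \<le> 1" "z = (1 - s) *\<^sub>R x + s *\<^sub>R y" using z(1) by (auto simp: closed_segment_def)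
  have "w \<bullet> z = (1 - s) * (w \<bullet> x) + s * (w \<bullet> y)" using s(3) by (simp add: inner_add_right)
  then have "w \<bullet> z \<in> closed_segment (w \<bullet> x) (w \<bullet> y)" using s by (auto simp: closed_segment_def)
  then have "(w \<bullet> x \<le> w \<bullet> z \<and> w \<bullet> z \<le> w \<bullet> y) \<or> (w \<bullet> y \<le> w \<bullet> z \<and> w \<bullet> z \<le> w \<bullet> x)"
    by (auto simp: closed_segment_eq_real_ivl split: if_splits)
  moreover have "w \<bullet> z \<in> levels (Suc n)" using w by simp
  ultimately show False using u w x(1) y(1) by (auto simp: unseparated_def)
qed

text \<open>Both points undergo the same shear and the same reflection, so their coordinates are
  shifted by one common constant and coordinate differences survive.\<close>

lemma T_same_atom:
  assumes A: "A \<in> U" "p \<in> A" "q \<in> A"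
  shows "\<exists>j\<in>I. \<exists>v. T p \<in> sheet j v \<and> T q \<in> sheet j v"
    "\<And>w. w \<in> W \<Longrightarrow> w \<bullet> snd (T p) = 0 \<Longrightarrow> \<exists>w'\<in>W. \<exists>j\<in>I. w' \<bullet> snd p = 0 \<and>
       w \<bullet> fst (T p) = w' \<bullet> fst p - 2 * offset j * (w' \<bullet> N j) \<and>
       w \<bullet> fst (T q) = w' \<bullet> fst q - 2 * offset j * (w' \<bullet> N j)"
proof -
  obtain i j v P where P: "A = P \<times> {v}" "\<And>x. x \<in> P \<Longrightarrow> transit i j v x"
    using U_structure[OF A(1)] by metis
  obtain x y where x: "p = (x, v)" "x \<in> P" "q = (y, v)" "y \<in> P" using A P by auto
  note t = P(2)[OF x(2)] P(2)[OF x(4)]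
  have j: "j \<in> I" using transitD(2)[OF t(1)] .
  show "\<exists>j\<in>I. \<exists>v. T p \<in> sheet j v \<and> T q \<in> sheet j v"
    by (rule bexI[OF _ j], rule exI[of _ "reflect (N j) v"])
      (simp add: sheet_def x billiard_map_transit[OF t(1)] billiard_map_transit[OF t(2)] transitD(5)[OF t(1)] transitD(5)[OF t(2)])
  fix w assume w: "w \<in> W" "w \<bullet> snd (T p) = 0"
  then have w0: "w \<bullet> reflect (N j) v = 0" by (simp add: x billiard_map_transit[OF t(1)])
  show "\<exists>w'\<in>W. \<exists>j\<in>I. w' \<bullet> snd p = 0 \<and>
       w \<bullet> fst (T p) = w' \<bullet> fst p - 2 * offset j * (w' \<bullet> N j) \<and>
       w \<bullet> fst (T q) = w' \<bullet> fst q - 2 * offset j * (w' \<bullet> N j)"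
    by (rule bexI[OF _ W_reflect[OF w(1) j]], rule bexI[OF _ j])
      (use inner_T[OF t(1) w0] inner_T[OF t(2) w0] x in simp)
qed

lemma unseparated_same_code:
  "itinerary n p \<Longrightarrow> i \<in> I \<Longrightarrow> p \<in> sheet i v \<Longrightarrow> q \<in> sheet i v \<Longrightarrow> unseparated n p q \<Longrightarrow>
    code n q = code n p"
proof (induction n arbitrary: p q i v)
  case (Suc n)
  obtain A where A: "A \<in> U" "p \<in> A" using Suc.prems by auto
  have q: "q \<in> A" using unseparated_same_atom A Suc.prems by blast
  obtain j v' where j: "j \<in> I" "T p \<in> sheet j v'" "T q \<in> sheet j v'"
    using T_same_atom(1)[OF A q] by blast
  have "unseparated n (T p) (T q)" unfolding unseparated_def
  proof (intro ballI impI)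
    fix w z assume w: "w \<in> W" "w \<bullet> snd (T p) = 0" and z: "z \<in> levels n"
    obtain w' k where w': "w' \<in> W" "k \<in> I" "w' \<bullet> snd p = 0"
       "w \<bullet> fst (T p) = w' \<bullet> fst p - 2 * offset k * (w' \<bullet> N k)"
       "w \<bullet> fst (T q) = w' \<bullet> fst q - 2 * offset k * (w' \<bullet> N k)"
      using T_same_atom(2)[OF A q w] by blast
    have "z + 2 * offset k * (w' \<bullet> N k) \<in> levels (Suc n)" using z w' by auto
    then have "\<not> (w' \<bullet> fst p \<le> z + 2 * offset k * (w' \<bullet> N k) \<and> z + 2 * offset k * (w' \<bullet> N k) \<le> w' \<bullet> fst q)"
      "\<not> (w' \<bullet> fst q \<le> z + 2 * offset k * (w' \<bullet> N k) \<and> z + 2 * offset k * (w' \<bullet> N k) \<le> w' \<bullet> fst p)"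
      using Suc.prems(5) w'(1,3) unfolding unseparated_def by blast+
    then show "\<not> (w \<bullet> fst (T p) \<le> z \<and> z \<le> w \<bullet> fst (T q)) \<and> \<not> (w \<bullet> fst (T q) \<le> z \<and> z \<le> w \<bullet> fst (T p))"
      unfolding w'(4,5) by linarith
  qed
  then have "code n (T q) = code n (T p)" using Suc.IH[OF _ j] Suc.prems(1) by simp
  then show ?case using atom_eq[OF A] atom_eq[OF A(1) q] by simp
qed simp

text \<open>Only coordinates orthogonal to the direction are controlled, since the others are not
  preserved by the flight.\<close>

definition close :: "real \<Rightarrow> phase \<Rightarrow> phase \<Rightarrow> bool" where
  "close \<delta> p q \<longleftrightarrow> (\<forall>w\<in>W. w \<bullet> snd p = 0 \<longrightarrow> \<bar>w \<bullet> fst p - w \<bullet> fst q\<bar> < \<delta>)"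

text \<open>Agreement of the codes keeps both orbits in common atoms, so all shifts agree. After at
  least one step the common arrival face puts them on one sheet.\<close>

lemma same_code_funpow:
  "itinerary m p \<Longrightarrow> itinerary m q \<Longrightarrow> code m p = code m q \<Longrightarrow> close \<delta> p q \<Longrightarrow>
    close \<delta> ((T ^^ m) p) ((T ^^ m) q) \<and>
    (m > 0 \<longrightarrow> (\<exists>j\<in>I. \<exists>v. (T ^^ m) p \<in> sheet j v \<and> (T ^^ m) q \<in> sheet j v))"
proof (induction m arbitrary: p q)
  case (Suc m)
  obtain A B where A: "A \<in> U" "p \<in> A" "B \<in> U" "q \<in> B" using Suc.prems by auto
  then have q: "q \<in> A" using Suc.prems(3) atom_eq[OF A(1,2)] atom_eq[OF A(3,4)] by simp
  have "close \<delta> (T p) (T q)" unfolding close_def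
  proof (intro ballI impI)
    fix w assume w: "w \<in> W" "w \<bullet> snd (T p) = 0"
    obtain w' k where "w' \<in> W" "w' \<bullet> snd p = 0"
       "w \<bullet> fst (T p) = w' \<bullet> fst p - 2 * offset k * (w' \<bullet> N k)"
       "w \<bullet> fst (T q) = w' \<bullet> fst q - 2 * offset k * (w' \<bullet> N k)"
      using T_same_atom(2)[OF A(1,2) q w] by blast
    then show "\<bar>w \<bullet> fst (T p) - w \<bullet> fst (T q)\<bar> < \<delta>" using Suc.prems(4) by (simp add: close_def)
  qed
  then have "close \<delta> ((T ^^ m) (T p)) ((T ^^ m) (T q)) \<and>
    (m > 0 \<longrightarrow> (\<exists>j\<in>I. \<exists>v. (T ^^ m) (T p) \<in> sheet j v \<and> (T ^^ m) (T q) \<in> sheet j v))"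
    using Suc.IH[of "T p" "T q"] Suc.prems by simp
  then show ?case using T_same_atom(1)[OF A(1,2) q]
    by (cases m) (simp_all add: funpow_swap1)
qed simp

text \<open>In a set narrower than the gap at most one level separates the values of a given
  coordinate, so the side of that level is one bit for each element of \<open>W\<close>.\<close>

lemma card_code_small_set:
  assumes gap: "\<forall>a\<in>levels n. \<forall>b\<in>levels n. a \<noteq> b \<longrightarrow> \<delta> \<le> \<bar>a - b\<bar>"
    and i: "i \<in> I" "A \<subseteq> sheet i v" and g: "\<And>p. p \<in> A \<Longrightarrow> generic n p"
    and c: "\<And>p q. p \<in> A \<Longrightarrow> q \<in> A \<Longrightarrow> close \<delta> p q"
  shows "finite (code n ` A) \<and> card (code n ` A) \<le> 2 ^ card W"
proof -
  \<comment> \<open>The bit for \<open>w\<close> is set when \<open>p\<close> lies above a level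
    that has a point of \<open>A\<close> below it; the separating level need not be named.\<close>
  define \<sigma> where "\<sigma> p = {w\<in>W. w \<bullet> v = 0 \<and> (\<exists>z\<in>levels n. z < w \<bullet> fst p \<and> (\<exists>q\<in>A. w \<bullet> fst q < z))}" for p :: phase
  have snd: "snd p = v" if "p \<in> A" for p using i(2) that by (auto simp: sheet_def)
  have le: "\<not> (w \<bullet> fst p \<le> z \<and> z \<le> w \<bullet> fst q)"
    if pq: "p \<in> A" "q \<in> A" "\<sigma> p = \<sigma> q" and w: "w \<in> W" "w \<bullet> v = 0" and z: "z \<in> levels n" for p q w z
  proof
    assume a: "w \<bullet> fst p \<le> z \<and> z \<le> w \<bullet> fst q"
    have "w \<bullet> fst p \<noteq> z" "w \<bullet> fst q \<noteq> z" using g[OF pq(1)] g[OF pq(2)] w z snd pq(1,2) by (auto simp: generic_def)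
    then have s: "w \<bullet> fst p < z" "z < w \<bullet> fst q" using a by auto
    then have "w \<in> \<sigma> q" using w z pq(1) by (auto simp: \<sigma>_def)
    then have "w \<in> \<sigma> p" using pq(3) by simp
    then obtain z' r where z': "z' \<in> levels n" "z' < w \<bullet> fst p" "r \<in> A" "w \<bullet> fst r < z'"
      by (auto simp: \<sigma>_def)
    \<comment> \<open>In the \<open>w\<close> coordinate the order is now \<open>r\<close>,
      \<open>z'\<close>, \<open>p\<close>, \<open>z\<close>, \<open>q\<close>: two distinct levels
      would fit into a width below the gap.\<close>
    have "\<bar>w \<bullet> fst r - w \<bullet> fst q\<bar> < \<delta>" using c[OF z'(3) pq(2)] w snd[OF z'(3)] by (simp add: close_def)
    then have "\<bar>z' - z\<bar> < \<delta>" "z' \<noteq> z" using z' s by linarith+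
    then show False using gap z z'(1) by force
  qed
  have same: "code n p = code n q" if pq: "p \<in> A" "q \<in> A" "\<sigma> p = \<sigma> q" for p q
  proof -
    have "unseparated n q p" unfolding unseparated_def
      using le[OF pq] le[OF pq(2,1) pq(3)[symmetric]] snd[OF pq(2)] by auto
    then show ?thesis
      using unseparated_same_code[of n q i v p] g[OF pq(2)] pq(1,2) i by (auto simp: generic_def)
  qed
  define h where "h s = code n (SOME p. p \<in> A \<and> \<sigma> p = s)" for s
  have h: "code n p = h (\<sigma> p)" if p: "p \<in> A" for p
  proof -
    have "(SOME q. q \<in> A \<and> \<sigma> q = \<sigma> p) \<in> A \<and> \<sigma> (SOME q. q \<in> A \<and> \<sigma> q = \<sigma> p) = \<sigma> p"
      by (rule someI[of _ p]) (simp add: p)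
    then show ?thesis unfolding h_def by (intro same[OF p]) auto
  qed
  have sub: "code n ` A \<subseteq> h ` Pow W" using h by (auto simp: \<sigma>_def)
  have fin: "finite (h ` Pow W)" using finite_W by simp
  have "card (code n ` A) \<le> card (h ` Pow W)" using sub fin by (rule card_mono[rotated])
  also have "\<dots> \<le> card (Pow W)" using finite_W by (intro card_image_le) simp
  finally show ?thesis using finite_subset[OF sub fin] finite_W by (simp add: card_Pow)
qed

text \<open>Blocks of length \<open>L\<close> multiply the bound: the part of \<open>A\<close>
  sharing the first \<open>L\<close> symbols is carried by \<open>T ^^ L\<close> into one sheet,
  again close and generic for the remaining time. The inequality \<open>n \<le> L * m\<close> lets
  the last block be shorter.\<close>

lemma card_code_le:
  assumes gap: "\<forall>a\<in>levels L. \<forall>b\<in>levels L. a \<noteq> b \<longrightarrow> \<delta> \<le> \<bar>a - b\<bar>" and L: "L > 0"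
  shows "n \<le> L * m \<Longrightarrow> i \<in> I \<Longrightarrow> A \<subseteq> sheet i v \<Longrightarrow> (\<And>p. p \<in> A \<Longrightarrow> generic n p) \<Longrightarrow>
    (\<And>p q. p \<in> A \<Longrightarrow> q \<in> A \<Longrightarrow> close \<delta> p q) \<Longrightarrow>
    finite (code n ` A) \<and> card (code n ` A) \<le> (2 ^ card W) ^ m"
proof (induction m arbitrary: n A i v)
  case 0
  then have "code n ` A = {} \<or> code n ` A = {[]}" by auto
  then show ?case by auto
next
  case (Suc m)
  show ?case
  proof (cases "n \<le> L")
    case True
    have "levels n \<subseteq> levels L" by (rule levels_mono[OF True])
    then have "\<forall>a\<in>levels n. \<forall>b\<in>levels n. a \<noteq> b \<longrightarrow> \<delta> \<le> \<bar>a - b\<bar>" using gap by blast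
    then have "finite (code n ` A) \<and> card (code n ` A) \<le> 2 ^ card W"
      using card_code_small_set Suc.prems by blast
    moreover have "(2::nat) ^ card W \<le> (2 ^ card W) ^ Suc m" by (rule self_le_power) simp_all
    ultimately show ?thesis by (meson order_trans)
  next
    case False
    define n' where "n' = n - L"
    have n: "n = L + n'" "n' \<le> L * m" using False Suc.prems(1) by (auto simp: n'_def)
    define B where "B c = (T ^^ L) ` {p\<in>A. code L p = c}" for c
    have fc: "finite (code L ` A) \<and> card (code L ` A) \<le> 2 ^ card W"
      using card_code_small_set[OF gap Suc.prems(2,3) generic_mono[OF Suc.prems(4)]] Suc.prems(5) False by simp
    have IH: "finite (code n' ` B c) \<and> card (code n' ` B c) \<le> (2 ^ card W) ^ m" if c: "c \<in> code L ` A" for c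
    proof -
      obtain p0 where p0: "p0 \<in> A" "code L p0 = c" using c by blast
      have it: "itinerary L p" if "p \<in> A" for p
        using Suc.prems(4)[OF that] n(1) itinerary_add by (auto simp: generic_def)
      have pair: "close \<delta> ((T ^^ L) p) ((T ^^ L) q) \<and> (\<exists>j\<in>I. \<exists>v. (T ^^ L) p \<in> sheet j v \<and> (T ^^ L) q \<in> sheet j v)"
        if "p \<in> A" "q \<in> A" "code L p = c" "code L q = c" for p q
        using same_code_funpow[of L p q \<delta>] it that Suc.prems(5) L by auto
      obtain j v' where j: "j \<in> I" "(T ^^ L) p0 \<in> sheet j v'" using pair[OF p0(1) p0(1) p0(2) p0(2)] by blast
      have "B c \<subseteq> sheet j v'"
      proof
        fix q assume "q \<in> B c"
        then obtain p where p: "p \<in> A" "code L p = c" "q = (T ^^ L) p" by (auto simp: B_def)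
        obtain k u where "k \<in> I" "(T ^^ L) p0 \<in> sheet k u" "q \<in> sheet k u" using pair[OF p0(1) p(1) p0(2) p(2)] p(3) by blast
        moreover then have "k = j" "u = v'" using j face_core_index_unique face_core_subset
          by (auto simp: sheet_def) (metis subsetD)
        ultimately show "q \<in> sheet j v'" by simp
      qed
      moreover have "generic n' q" if "q \<in> B c" for q
        using that Suc.prems(4) generic_funpow[of L n'] n(1) by (auto simp: B_def)
      moreover have "close \<delta> q q'" if "q \<in> B c" "q' \<in> B c" for q q' using that pair by (auto simp: B_def)
      ultimately show ?thesis using Suc.IH[OF n(2) j(1)] by blast
    qed
    have sub: "code n ` A \<subseteq> (\<Union>c\<in>code L ` A. (\<lambda>d. c @ d) ` code n' ` B c)"
      unfolding n(1) code_add B_def by auto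
    have fin: "finite (\<Union>c\<in>code L ` A. (\<lambda>d. c @ d) ` code n' ` B c)" using fc IH by blast
    have "card (code n ` A) \<le> card (\<Union>c\<in>code L ` A. (\<lambda>d. c @ d) ` code n' ` B c)"
      by (rule card_mono[OF fin sub])
    also have "\<dots> \<le> (\<Sum>c\<in>code L ` A. card ((\<lambda>d. c @ d) ` code n' ` B c))"
      using fc by (intro card_UN_le) simp
    also have "\<dots> \<le> (\<Sum>c\<in>code L ` A. (2 ^ card W) ^ m)"
    proof (rule sum_mono)
      fix c assume "c \<in> code L ` A"
      then show "card ((\<lambda>d. c @ d) ` code n' ` B c) \<le> (2 ^ card W) ^ m"
        using IH[of c] card_image_le[of "code n' ` B c" "\<lambda>d. c @ d"] by simp
    qed
    also have "\<dots> \<le> 2 ^ card W * (2 ^ card W) ^ m" using fc by (simp add: mult_right_mono)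
    finally show ?thesis using finite_subset[OF sub fin] by simp
  qed
qed


section \<open>Codes realised by generic points\<close>

lemma code_open:
  "itinerary n (x, v) \<Longrightarrow> i \<in> I \<Longrightarrow> x \<in> face_core i \<Longrightarrow>
    \<exists>e>0. \<forall>y\<in>ball x e \<inter> face_plane i. itinerary n (y, v) \<and> code n (y, v) = code n (x, v)"
proof (induction n arbitrary: x v i)
  case 0
  show ?case by (intro exI[of _ 1]) simp
next
  case (Suc n)
  obtain A where A: "A \<in> U" "(x, v) \<in> A" using Suc.prems by auto
  obtain i' j v' P where P: "A = P \<times> {v'}" "\<And>x. x \<in> P \<Longrightarrow> transit i' j v' x"
    "affine hull P = face_plane i'" "rel_interior P = P" using U_structure[OF A(1)] by metis
  have x: "x \<in> P" "v' = v" using A P by auto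
  note t = P(2)[unfolded x(2)]
  note d = transitD[OF t[OF x(1)]]
  have ii: "i' = i" using face_core_index_unique[OF d(1) Suc.prems(2) d(4)] Suc.prems(3) face_core_subset by blast
  have "x \<in> rel_interior P" using x P(4) by simp
  then obtain e1 where e1: "e1 > 0" "ball x e1 \<inter> face_plane i \<subseteq> P"
    unfolding mem_rel_interior_ball P(3) ii by blast
  note Tx = billiard_map_transit[OF t[OF x(1)]]
  have "itinerary n (shear i' j v x, reflect (N j) v)" using Suc.prems(1) Tx by simp
  then obtain e2 where e2: "e2 > 0" "\<forall>y\<in>ball (shear i' j v x) e2 \<inter> face_plane j.
      itinerary n (y, reflect (N j) v) \<and> code n (y, reflect (N j) v) = code n (T (x, v))"
    using Suc.IH[OF _ d(2,5)] Tx by metis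
  have "isCont (shear i' j v) x"
    using continuous_on_shear[of UNIV] by (simp add: continuous_on_eq_continuous_at)
  then obtain e3 where e3: "e3 > 0" "\<And>y. dist y x < e3 \<Longrightarrow> dist (shear i' j v y) (shear i' j v x) < e2"
    using e2(1) unfolding continuous_at_eps_delta by blast
  have "itinerary (Suc n) (y, v) \<and> code (Suc n) (y, v) = code (Suc n) (x, v)"
    if y: "y \<in> ball x (min e1 e3)" "y \<in> face_plane i" for y
  proof -
    have yP: "y \<in> P" using e1(2) y by auto
    note ty = t[OF yP]
    have "shear i' j v y \<in> face_plane j" using shear_plane transitD(7,9)[OF ty] by simp
    then have "itinerary n (T (y, v)) \<and> code n (T (y, v)) = code n (T (x, v))"
      using e2(2) e3(2)[of y] y(1) billiard_map_transit[OF ty] by (simp add: dist_commute)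
    moreover have "(y, v) \<in> A" using yP P(1) x(2) by simp
    ultimately show ?thesis using A atom_eq[OF A] atom_eq[OF A(1), of "(y, v)"] by auto
  qed
  then show ?case using e1(1) e3(1) by (intro exI[of _ "min e1 e3"]) auto
qed

lemma itinerary_sheet:
  assumes "itinerary n p" "n > 0"
  obtains i v where "i \<in> I" "v \<in> dirs" "p \<in> sheet i v" "N i \<bullet> v > 0"
proof -
  obtain A where A: "A \<in> U" "p \<in> A" using assms by (cases n) auto
  obtain i j v P where P: "A = P \<times> {v}" "\<And>x. x \<in> P \<Longrightarrow> transit i j v x" using U_structure[OF A(1)] by metis
  obtain x where x: "p = (x, v)" "x \<in> P" using A P by auto
  show thesis using that transitD[OF P(2)[OF x(2)]] x by (simp add: sheet_def)
qed

text \<open>A code is constant on a disc of the face plane, and finitely many planes parallel to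
  \<open>v\<close> cannot cover such a disc; so counting generic points loses no code.\<close>

lemma generic_same_code:
  assumes "itinerary n p" "n > 0"
  shows "\<exists>q. generic n q \<and> code n q = code n p"
proof -
  obtain i v where i: "i \<in> I" "p \<in> sheet i v" "N i \<bullet> v > 0" using itinerary_sheet[OF assms] by metis
  obtain x where x: "p = (x, v)" "x \<in> face_core i" using i by (auto simp: sheet_def)
  obtain e where e: "e > 0" "\<forall>y\<in>ball x e \<inter> face_plane i. itinerary n (y, v) \<and> code n (y, v) = code n (x, v)"
    using code_open[of n x v i] assms(1) i(1) x by blast
  let ?K = "{w\<in>W. w \<bullet> v = 0} \<times> levels n"
  have "finite ?K" using finite_W finite_levels by simp
  moreover have "\<forall>(w,d)\<in>?K. w \<noteq> 0 \<and> w \<bullet> v = 0" using W_nz by auto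
  ultimately obtain y where y: "N i \<bullet> y = N i \<bullet> x" "dist x y < e" "\<forall>(w,d)\<in>?K. w \<bullet> y \<noteq> d"
    using hyperplane_point_off_planes[of ?K v "N i" e x] i(3) e(1) by auto
  have "y \<in> ball x e \<inter> face_plane i" using y face_core_plane[OF i(1) x(2)] by (simp add: face_plane_def)
  then have "itinerary n (y, v)" "code n (y, v) = code n p" using e(2) x by auto
  then show ?thesis using y(3) by (intro exI[of _ "(y, v)"]) (auto simp: generic_def)
qed

text \<open>Disjointness of the atoms turns membership in a join atom into equality of codes, so
  nonempty join atoms are fibres of \<open>code\<close> among the points with an itinerary.\<close>

lemma itinerary_code_iff:
  assumes "\<forall>k<n. f k \<in> U"
  shows "(\<forall>k<n. (T ^^ k) p \<in> f k) \<longleftrightarrow> itinerary n p \<and> code n p = map f [0..<n]"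
  using assms
proof (induction n arbitrary: p f)
  case (Suc n)
  have IH: "(\<forall>k<n. (T ^^ k) (T p) \<in> f (Suc k)) \<longleftrightarrow> itinerary n (T p) \<and> code n (T p) = map (f \<circ> Suc) [0..<n]"
    using Suc.IH[of "f \<circ> Suc" "T p"] Suc.prems by (simp add: comp_def)
  have f0: "f 0 \<in> U" using Suc.prems by simp
  have 0: "p \<in> f 0 \<longleftrightarrow> p \<in> \<Union>U \<and> atom p = f 0" using f0 atom_eq by (metis Union_iff)
  have m: "map f [0..<Suc n] = f 0 # map (f \<circ> Suc) [0..<n]"
    by (simp add: map_upt_Suc del: upt_Suc)
  have "(\<forall>k<Suc n. (T ^^ k) p \<in> f k) \<longleftrightarrow> p \<in> f 0 \<and> (\<forall>k<n. (T ^^ k) (T p) \<in> f (Suc k))"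
    by (simp add: All_less_Suc2 funpow_swap1)
  then show ?case unfolding m using IH 0 by auto
qed simp

section \<open>Counting join atoms and the entropy bound\<close>

lemma join_atoms_subset:
  assumes "n > 0"
  shows "join_atoms T U n \<subseteq> (\<lambda>c. {q. itinerary n q \<and> code n q = c}) ` code n ` {p. generic n p}"
proof
  fix C assume "C \<in> join_atoms T U n"
  then obtain f p where f: "\<forall>k<n. f k \<in> U" "C = {p. \<forall>k<n. (T ^^ k) p \<in> f k}" "p \<in> C"
    unfolding join_atoms_def by blast
  have C: "C = {q. itinerary n q \<and> code n q = map f [0..<n]}"
    unfolding f(2) itinerary_code_iff[OF f(1)] ..
  then have p: "itinerary n p" "code n p = map f [0..<n]" using f(3) by auto
  obtain q where "generic n q" "code n q = map f [0..<n]" using generic_same_code[OF p(1) assms] p(2) by auto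
  then show "C \<in> (\<lambda>c. {q. itinerary n q \<and> code n q = c}) ` code n ` {p. generic n p}" unfolding C
    by (intro image_eqI[of _ _ "map f [0..<n]"] image_eqI[of _ "code n" q]) auto
qed

lemma card_join_atoms_le:
  assumes L: "L > 0"
  shows "\<exists>c. \<forall>n m. 0 < n \<longrightarrow> n \<le> L * m \<longrightarrow> card (join_atoms T U n) \<le> c * (2 ^ card W) ^ m"
proof -
  obtain \<delta> where \<delta>: "\<delta> > 0" "\<forall>a\<in>levels L. \<forall>b\<in>levels L. a \<noteq> b \<longrightarrow> \<delta> \<le> \<bar>a - b\<bar>"
    using finite_min_gap[OF finite_levels] by blast
  \<comment> \<open>\<open>M\<close> dominates the norms of all normals, the \<open>+ 1\<close>
    making it positive for an empty \<open>W\<close>. Two points in a ball of radius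
    \<open>\<delta> / (2 * M)\<close> then differ by less than \<open>\<delta>\<close> in every
    coordinate.\<close>
  define M where "M = (\<Sum>w\<in>W. norm w) + 1"
  have M: "M > 0" using sum_nonneg[of W norm] by (simp add: M_def add_nonneg_pos)
  have wM: "norm w \<le> M" if "w \<in> W" for w
    using member_le_sum[of w W norm] that finite_W by (simp add: M_def)
  define r where "r = \<delta> / (2 * M)"
  have r: "r > 0" using \<delta> M by (simp add: r_def)
  have "compact V" by (rule compact_V)
  then obtain B where B: "finite B" "V \<subseteq> (\<Union>b\<in>B. ball b r)"
    using r by (metis compact_eq_totally_bounded)
  let ?X = "I \<times> dirs \<times> B"
  \<comment> \<open>Faces, directions and small balls index finitely many pieces. Their number
    depends on \<open>L\<close> through \<open>r\<close> but not on \<open>n\<close>, and becomes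
    the constant \<open>c\<close>.\<close>
  define A where "A = (\<lambda>n (i, v, b). {p. generic n p \<and> p \<in> sheet i v \<and> fst p \<in> ball b r})"
  have fX: "finite ?X" using finite_I finite_dirs B by simp
  have "card (join_atoms T U n) \<le> card ?X * (2 ^ card W) ^ m" if n: "0 < n" "n \<le> L * m" for n m
  proof -
    have count: "finite (code n ` A n a) \<and> card (code n ` A n a) \<le> (2 ^ card W) ^ m" if "a \<in> ?X" for a
    proof -
      obtain i v b where a: "a = (i, v, b)" "i \<in> I" using \<open>a \<in> ?X\<close> by auto
      have cl: "close \<delta> p q" if "p \<in> A n a" "q \<in> A n a" for p q
        unfolding close_def
      proof (intro ballI impI)
        fix w assume w: "w \<in> W"
        have "norm (fst p - fst q) < 2 * r"
          using that a(1) dist_triangle_less_add[of "fst p" b r "fst q" r] by (auto simp: A_def dist_norm norm_minus_commute)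
        have "\<bar>w \<bullet> fst p - w \<bullet> fst q\<bar> \<le> norm w * norm (fst p - fst q)"
          using Cauchy_Schwarz_ineq2[of w "fst p - fst q"] by (simp add: inner_diff_right)
        also have "\<dots> \<le> M * norm (fst p - fst q)" using wM[OF w] by (simp add: mult_right_mono)
        also have "\<dots> < M * (2 * r)" using M \<open>norm (fst p - fst q) < 2 * r\<close> by simp
        also have "\<dots> = \<delta>" using M by (simp add: r_def)
        finally show "\<bar>w \<bullet> fst p - w \<bullet> fst q\<bar> < \<delta>" .
      qed
      show ?thesis
        by (rule card_code_le[OF \<delta>(2) L n(2) a(2), of _ v]) (use cl a in \<open>auto simp: A_def\<close>)
    qed
    have "{p. generic n p} \<subseteq> (\<Union>a\<in>?X. A n a)"
    proof
      fix p assume "p \<in> {p. generic n p}"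
      then have p: "generic n p" by simp
      then obtain i v where i: "i \<in> I" "v \<in> dirs" "p \<in> sheet i v"
        using itinerary_sheet n(1) by (metis generic_def)
      have "fst p \<in> frontier V" using i face_core_frontier by (auto simp: sheet_def)
      then have "fst p \<in> V" using compact_V compact_imp_closed frontier_subset_closed by blast
      then obtain b where "b \<in> B" "fst p \<in> ball b r" using B by blast
      then have "p \<in> A n (i, v, b)" "(i, v, b) \<in> ?X" using i p by (auto simp: A_def)
      then show "p \<in> (\<Union>a\<in>?X. A n a)" by blast
    qed
    then have sub: "code n ` {p. generic n p} \<subseteq> (\<Union>a\<in>?X. code n ` A n a)" by blast
    have fin: "finite (\<Union>a\<in>?X. code n ` A n a)" using fX count by blast
    have fin': "finite (code n ` {p. generic n p})" using sub fin by (rule finite_subset)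
    have "card (join_atoms T U n) \<le> card ((\<lambda>c. {q. itinerary n q \<and> code n q = c}) ` code n ` {p. generic n p})"
      using fin' by (intro card_mono join_atoms_subset n(1)) simp
    also have "\<dots> \<le> card (code n ` {p. generic n p})" using fin' by (rule card_image_le)
    also have "\<dots> \<le> card (\<Union>a\<in>?X. code n ` A n a)" using fin sub by (rule card_mono)
    also have "\<dots> \<le> (\<Sum>a\<in>?X. card (code n ` A n a))" using fX by (rule card_UN_le)
    also have "\<dots> \<le> (\<Sum>a\<in>?X. (2 ^ card W) ^ m)" using count by (intro sum_mono) blast
    finally show ?thesis by simp
  qed
  then show ?thesis by blast
qed

text \<open>For fixed \<open>L\<close> the logarithm of the atom count grows by at most
  \<open>M\<close> per block of \<open>L\<close> steps, and everything else vanishes after division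
  by \<open>n\<close>. The entropy does not depend on \<open>L\<close>, which may then grow.\<close>

lemma partition_entropy_le_0: "partition_entropy T U \<le> 0"
proof -
  define M where "M = ln (2 ^ card W :: real)"
  have M0: "M \<ge> 0" by (simp add: M_def)
  have le: "partition_entropy T U \<le> ereal (M / real L)" if L: "L > 0" for L :: nat
  proof -
    obtain c where c: "\<And>n m. 0 < n \<Longrightarrow> n \<le> L * m \<Longrightarrow> card (join_atoms T U n) \<le> c * (2 ^ card W) ^ m"
      using card_join_atoms_le[OF L] by blast
    \<comment> \<open>The extra \<open>M\<close> pays for the incomplete last block in
      \<open>n div L + 1\<close>; the \<open>+ 1\<close> keeps the logarithm nonnegative also for
      \<open>c = 0\<close>.\<close>
    define K where "K = ln (real c + 1) + M"
    have bound: "ln (real (card (join_atoms T U n))) / real n \<le> K / real n + M / real L" if n: "n > 0" for n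
    proof -
      let ?k = "card (join_atoms T U n)" and ?m = "n div L + 1"
      have "n \<le> L * ?m" using L using dividend_less_div_times[OF L, of n] by (simp add: algebra_simps)
      then have k: "?k \<le> c * (2 ^ card W) ^ ?m" using c n by blast
      have K0: "K \<ge> 0" using M0 by (simp add: K_def)
      have "ln (real ?k) \<le> K + real n / real L * M"
      proof (cases "?k = 0")
        \<comment> \<open>Here \<open>ln 0 = 0\<close>, so the claim reduces to nonnegativity of the
          bound.\<close>
        case True
        then show ?thesis using K0 M0 by simp
      next
        case False
        have "real ?k \<le> real (c * (2 ^ card W) ^ ?m)" using k by (simp only: of_nat_le_iff)
        also have "\<dots> \<le> (real c + 1) * (2 ^ card W) ^ ?m" by simp
        finally have "ln (real ?k) \<le> ln ((real c + 1) * (2 ^ card W) ^ ?m)" using False by (intro ln_mono) auto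
        also have "\<dots> = ln (real c + 1) + ln ((2 ^ card W) ^ ?m)" by (intro ln_mult_pos) (auto simp: add_nonneg_pos)
        also have "\<dots> = ln (real c + 1) + real ?m * M" unfolding M_def by (simp only: ln_realpow zero_less_power zero_less_numeral)
        also have "\<dots> = K + real (n div L) * M" by (simp add: K_def algebra_simps)
        also have "real (n div L) * M \<le> real n / real L * M" using M0 of_nat_div_le_of_nat[of n L] by (intro mult_right_mono) auto
        finally show ?thesis by simp
      qed
      then have "ln (real ?k) / real n \<le> (K + real n / real L * M) / real n" using n by (intro divide_right_mono) auto
      also have "\<dots> = K / real n + M / real L" using n by (simp add: add_divide_distrib)
      finally show ?thesis .
    qed
    have "partition_entropy T U \<le> limsup (\<lambda>n. ereal (K / real n + M / real L))"
      unfolding partition_entropy_def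
      by (rule Limsup_mono) (use bound in \<open>auto intro!: eventually_sequentiallyI[of 1]\<close>)
    also have "\<dots> = ereal (M / real L)"
    proof (rule lim_imp_Limsup)
      have "(\<lambda>n. K / real n) \<longlonglongrightarrow> 0" by (rule lim_const_over_n)
      then have "(\<lambda>n. K / real n + M / real L) \<longlonglongrightarrow> 0 + M / real L" by (intro tendsto_intros)
      then show "(\<lambda>n. ereal (K / real n + M / real L)) \<longlonglongrightarrow> ereal (M / real L)" by simp
    qed simp
    finally show ?thesis .
  qed
  have "(\<lambda>L. ereal (M / real L)) \<longlonglongrightarrow> 0"
    using lim_const_over_n[of M] by (simp add: zero_ereal_def)
  then show ?thesis
    by (rule tendsto_lowerbound) (use le in \<open>auto intro!: eventually_sequentiallyI[of 1]\<close>)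
qed

end

section \<open>Construction of the cut data\<close>

context rational_billiard begin

lemma norm_group: "g \<in> refl_group I N \<Longrightarrow> norm (g w) = norm w"
  by (induction rule: refl_group.induct) (auto simp: norm_reflect)

text \<open>Closing the finitely many normals under the finite group makes the set of cut directions
  independent of the number of iterations.\<close>
lemma cut_system_exists:
  assumes U: "polygon_partition S U" "refines U R"
  shows "\<exists>W Z. cut_system V I F N \<omega> U W Z"
proof -
  \<comment> \<open>The direction is read off from a chosen element of \<open>A\<close>, so that the
    choice of \<open>K\<close> depends on \<open>A\<close> alone.\<close>
  have "\<forall>A\<in>U. \<exists>K. finite K \<and> (\<forall>(w,d)\<in>K. w \<noteq> 0 \<and> w \<bullet> snd (SOME p. p \<in> A) = 0) \<and>
     (\<forall>P v. A = P \<times> {v} \<longrightarrow> (\<forall>x\<in>rel_frontier P. \<exists>(w,d)\<in>K. w \<bullet> x = d))"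
  proof
    fix A assume A: "A \<in> U"
    have "open_polygon A" using U A by (simp add: polygon_partition_def)
    then obtain P v where P: "A = P \<times> {v}" "P \<noteq> {}" "segment_covered (rel_frontier P)"
      unfolding open_polygon_def segment_covered_def by blast
    have "\<forall>P' v'. A = P' \<times> {v'} \<longrightarrow> P' = P" using P by blast
    moreover obtain K where "finite K" "\<forall>(w,d)\<in>K. w \<noteq> 0 \<and> w \<bullet> snd (SOME p. p \<in> A) = 0"
      "\<forall>x\<in>rel_frontier P. \<exists>(w,d)\<in>K. w \<bullet> x = d"
      using segment_covered_parallel_planes[OF P(3), of "snd (SOME p. p \<in> A)"] by (elim exE conjE)
    ultimately show "\<exists>K. finite K \<and> (\<forall>(w,d)\<in>K. w \<noteq> 0 \<and> w \<bullet> snd (SOME p. p \<in> A) = 0) \<and>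
        (\<forall>P v. A = P \<times> {v} \<longrightarrow> (\<forall>x\<in>rel_frontier P. \<exists>(w,d)\<in>K. w \<bullet> x = d))"
      by (intro exI[of _ K]) auto
  qed
  from bchoice[OF this] obtain K where K0: "\<forall>A\<in>U. finite (K A) \<and>
     (\<forall>(w,d)\<in>K A. w \<noteq> 0 \<and> w \<bullet> snd (SOME p. p \<in> A) = 0) \<and>
     (\<forall>P v. A = P \<times> {v} \<longrightarrow> (\<forall>x\<in>rel_frontier P. \<exists>(w,d)\<in>K A. w \<bullet> x = d))" ..
  then have K: "\<And>A. A \<in> U \<Longrightarrow> finite (K A)"
    "\<And>A w d. A \<in> U \<Longrightarrow> (w,d) \<in> K A \<Longrightarrow> w \<noteq> 0 \<and> w \<bullet> snd (SOME p. p \<in> A) = 0"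
    "\<And>A P v x. A \<in> U \<Longrightarrow> A = P \<times> {v} \<Longrightarrow> x \<in> rel_frontier P \<Longrightarrow> \<exists>(w,d)\<in>K A. w \<bullet> x = d"
    by auto
  have finU: "finite U" using U by (simp add: polygon_partition_def)
  define W where "W = (\<Union>A\<in>U. \<Union>k\<in>K A. \<Union>g\<in>refl_group I N. {g (fst k)})"
  define Z where "Z = (\<Union>A\<in>U. snd ` K A)"
  have "cut_system V I F N \<omega> U W Z"
  proof unfold_locales
    show "polygon_partition S U" "refines U R" by fact+
    show "finite W" "finite Z" unfolding W_def Z_def using finU K(1) finite_group by auto
    show "0 \<notin> W"
    proof
      assume "0 \<in> W"
      then obtain A w d g where g: "A \<in> U" "(w,d) \<in> K A" "g \<in> refl_group I N" "0 = g w" by (auto simp: W_def)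
      then have "norm w = 0" using norm_group[OF g(3), of w] by simp
      then show False using K(2)[OF g(1,2)] by simp
    qed
    show "reflect (N i) w \<in> W" if w: "w \<in> W" and i: "i \<in> I" for w i
    proof -
      obtain A k g where g: "A \<in> U" "k \<in> K A" "g \<in> refl_group I N" "w = g (fst k)" using w unfolding W_def by blast
      then have "reflect (N i) w = (reflect (N i) \<circ> g) (fst k)" by simp
      then show ?thesis using refl_group_step[OF g(3) i] g(1,2) unfolding W_def by blast
    qed
    show "\<exists>w\<in>W. w \<bullet> v = 0 \<and> w \<bullet> x \<in> Z" if P: "P \<times> {v} \<in> U" "x \<in> rel_frontier P" for P v x
    proof -
      obtain w d where w: "(w,d) \<in> K (P \<times> {v})" "w \<bullet> x = d" using K(3)[OF P(1) refl P(2)] by blast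
      have "P \<noteq> {}" using P(2) by auto
      then have "\<exists>p. p \<in> P \<times> {v}" by auto
      then have "(SOME p. p \<in> P \<times> {v}) \<in> P \<times> {v}" by (rule someI_ex)
      then have "snd (SOME p. p \<in> P \<times> {v}) = v" by auto
      then have "w \<bullet> v = 0" using K(2)[OF P(1) w(1)] by simp
      moreover have "id (fst (w,d)) \<in> W" unfolding W_def using P(1) w(1) refl_group_id[of I N] by blast
      moreover have "w \<bullet> x \<in> Z" unfolding Z_def using P(1) w by force
      ultimately show ?thesis by auto
    qed
  qed
  then show ?thesis by blast
qed

theorem poly_entropy_T: "poly_entropy S R T = 0"
proof (rule antisym)
  show "poly_entropy S R T \<le> 0" unfolding poly_entropy_def
  proof (rule SUP_least)
    fix U assume "U \<in> {U. polygon_partition S U \<and> refines U R}"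
    then obtain W Z where "cut_system V I F N \<omega> U W Z" using cut_system_exists by blast
    then show "partition_entropy T U \<le> 0" by (rule cut_system.partition_entropy_le_0)
  qed
  \<comment> \<open>For the lower bound \<open>R\<close> itself serves as the partition; no term is
    negative, a join of cardinality 0 contributing \<open>ln 0 = 0\<close>.\<close>
  have "0 \<le> ln (real k) / real n" for k n :: nat by (cases "k = 0") auto
  then have "0 \<le> partition_entropy T R" unfolding partition_entropy_def
    by (intro le_Limsup always_eventually) auto
  also have "\<dots> \<le> poly_entropy S R T" unfolding poly_entropy_def
    by (rule SUP_upper) (auto simp: polygon_partition_R refines_def)
  finally show "0 \<le> poly_entropy S R T" .
qed

end

theorem theorem9:
  fixes V :: "pt set" and I :: "'i set" and F :: "'i \<Rightarrow> pt set" and N :: "'i \<Rightarrow> pt"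
    and \<Omega> :: "pt set" and \<omega> :: pt
  assumes "rational_polytop V I F N"
    and "fundamental_polygon (refl_group I N) \<Omega>"
    and "\<omega> \<in> \<Omega>"
  shows "gen_polygon_exchange (cross_section I F N \<omega>) (discont_partition V I F N \<omega>)
           (billiard_map V I F N)
       \<and> poly_entropy (cross_section I F N \<omega>) (discont_partition V I F N \<omega>)
           (billiard_map V I F N) = 0"
proof -
  interpret rational_billiard V I F N \<omega>
    using assms(1) by unfold_locales (auto simp: rational_polytop_def)
  show ?thesis using gen_polygon_exchange_T poly_entropy_T by blast
qed

end
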